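(* Let $\Phi=(A;\{E_i\}_{i=0}^d;A^*;\{E^*_i\}_{i=0}^d)$ be a Leonard system in $\mathcal{A}$ with parameter array $(\{\theta_i\}_{i=0}^d;\{\theta^*_i\}_{i=0}^d;\{\varphi_i\}_{i=1}^d;\{\phi_i\}_{i=1}^d)$. Let $S^*$ denote the dual switching element for $\Phi$. Fix a nonzero $v^*_0\in E^*_0V$ and for $X\in\mathcal{A}$ let $X^\natural\in\mathrm{Mat}_{d+1}(\mathbb{K})$ denote the matrix representing $X$ with respect to the basis $\{\tau_i(A)v^*_0\}_{i=0}^d$ of $V$. Then each of $S^{*\natural}$, $(S^{*-1})^\natural$ is upper triangular. Moreover for $0\le i\le j\le d$ their $(i,j)$ entries are $$S^{*\natural}_{i,j}=\frac{[i,j-i,d-j]_q\,\phi_1\phi_2\cdots\phi_i\,\tau_{j-i}(\theta_d)}{\varphi_1\varphi_2\cdots\varphi_i},$$ $$(S^{*-1})^\natural_{i,j}=\frac{[i,j-i,d-j]_q\,\varphi_1\varphi_2\cdots\varphi_j\,\eta_{j-i}(\theta_0)}{\phi_1\phi_2\cdots\phi_j}.$$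
   Context: $\mathbb{K}$ is a field, $d\ge 0$ an integer, $\mathcal{A}$ a $\mathbb{K}$-algebra isomorphic to $\mathrm{Mat}_{d+1}(\mathbb{K})$ (matrices have rows and columns indexed by $0,1,\ldots,d$), $I$ its identity, and $V$ a simple left $\mathcal{A}$-module (so $\dim V=d+1$). The symbol $A^*$ is just a name for a second element (not a conjugate transpose). A matrix $Y$ represents $X\in\mathcal{A}$ with respect to a basis $\{v_i\}_{i=0}^d$ of $V$ if $Xv_j=\sum_{i=0}^dY_{ij}v_i$ for $0\le j\le d$. An element $A\in\mathcal{A}$ is multiplicity-free if it has $d+1$ mutually distinct eigenvalues in $\mathbb{K}$. For an ordering $\{\theta_i\}_{i=0}^d$ of these eigenvalues, the primitive idempotent of $A$ associated with $\theta_i$ is $E_i=\prod_{0\le j\le d,\,j\ne i}\frac{A-\theta_jI}{\theta_i-\theta_j}$. A Leonard system in $\mathcal{A}$ is a sequence $\Phi=(A;\{E_i\}_{i=0}^d;A^*;\{E^*_i\}_{i=0}^d)$ such that $A,A^*\in\mathcal{A}$ are multiplicity-free; $\{E_i\}_{i=0}^d$ (resp. $\{E^*_i\}_{i=0}^d$) is an ordering of the primitive idempotents of $A$ (resp. $A^*$); and for $0\le i,j\le d$ both $E_iA^*E_j$ and $E^*_iAE^*_j$ are zero if $|i-j|>1$ and nonzero if $|i-j|=1$. Let $\theta_i$ (resp. $\theta^*_i$) be the eigenvalue of $A$ (resp. $A^*$) associated with $E_i$ (resp. $E^*_i$). For $0\le i\le d$ put $\tau_i=(\lambda-\theta_0)\cdots(\lambda-\theta_{i-1})$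 and $\eta_i=(\lambda-\theta_d)(\lambda-\theta_{d-1})\cdots(\lambda-\theta_{d-i+1})$. The first and second split sequences of $\Phi$ are, for $1\le i\le d$, $\varphi_i=(\theta^*_0-\theta^*_i)\frac{\mathrm{tr}(\tau_i(A)E^*_0)}{\mathrm{tr}(\tau_{i-1}(A)E^*_0)}$ and $\phi_i=(\theta^*_0-\theta^*_i)\frac{\mathrm{tr}(\eta_i(A)E^*_0)}{\mathrm{tr}(\eta_{i-1}(A)E^*_0)}$ (the denominators are known to be nonzero, and all $\varphi_i,\phi_i$ are known to be nonzero). The parameter array of $\Phi$ is $(\{\theta_i\}_{i=0}^d;\{\theta^*_i\}_{i=0}^d;\{\varphi_i\}_{i=1}^d;\{\phi_i\}_{i=1}^d)$. The switching element for $\Phi$ is $S=\sum_{r=0}^d\frac{\phi_d\phi_{d-1}\cdots\phi_{d-r+1}}{\varphi_1\varphi_2\cdots\varphi_r}E_r$. The dual switching element $S^*$ for $\Phi$ is the switching element of the Leonard system $\Phi^*=(A^*;\{E^*_i\}_{i=0}^d;A;\{E_i\}_{i=0}^d)$; explicitly $S^*=\sum_{r=0}^d\frac{\phi_1\phi_2\cdots\phi_r}{\varphi_1\varphi_2\cdots\varphi_r}E^*_r$; it is invertible. The vectors $\tau_i(A)v^*_0$ $(0\le i\le d)$ are known to form a basis of $V$. Scalars $[r,s,t]_q$. It is known that $\frac{\theta_{i-2}-\theta_{i+1}}{\theta_{i-1}-\theta_i}$ and $\frac{\theta^*_{i-2}-\theta^*_{i+1}}{\theta^*_{i-1}-\theta^*_i}$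 are equal and independent of $i$ for $2\le i\le d-1$; $q$ is a nonzero scalar in the algebraic closure of $\mathbb{K}$ such that $q+q^{-1}+1$ is this common value. For nonnegative integers $r,s,t$ with $r+s+t\le d$ the scalar $[r,s,t]_q\in\mathbb{K}$ is defined as follows. If at least one of $r,s,t$ is $0$ (in particular whenever $d\le2$, where $q$ plays no role), $[r,s,t]_q=1$. Otherwise: if $q\ne1$ and $q\neq-1$, $[r,s,t]_q=\frac{(q;q)_{r+s}(q;q)_{r+t}(q;q)_{s+t}}{(q;q)_r(q;q)_s(q;q)_t(q;q)_{r+s+t}}$ with $(a;q)_n=(1-a)(1-aq)\cdots(1-aq^{n-1})$; if $q=1$ and $\mathrm{char}\,\mathbb{K}\ne2$, $[r,s,t]_q=\frac{(r+s)!(r+t)!(s+t)!}{r!\,s!\,t!\,(r+s+t)!}$; if $q=-1$ and $\mathrm{char}\,\mathbb{K}\neq2$, $[r,s,t]_q=0$ when $r,s,t$ are all odd and otherwise $[r,s,t]_q=\frac{\lfloor(r+s)/2\rfloor!\,\lfloor(r+t)/2\rfloor!\,\lfloor(s+t)/2\rfloor!}{\lfloor r/2\rfloor!\,\lfloor s/2\rfloor!\,\lfloor t/2\rfloor!\,\lfloor(r+s+t)/2\rfloor!}$; if $q=1$ and $\mathrm{char}\,\mathbb{K}=2$ (then $d\le3$, so $r=s=t=1$), $[r,s,t]_q=0$. (All denominators are nonzero in $\mathbb{K}$, respectively its algebraic closure.) *)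

theory Defs
  imports
    "HOL-Algebra.Algebraic_Closure_Type"
    "HOL-Computational_Algebra.Polynomial"
    "Jordan_Normal_Form.Char_Poly"
begin

section \<open>The algebra and its simple module\<close>

locale assoc_algebra = vector_space scale
  for scale :: "'k::field \<Rightarrow> 'a::ring_1 \<Rightarrow> 'a" +
  assumes scale_mult_left: "scale c x * y = scale c (x * y)"
    and scale_mult_right: "x * scale c y = scale c (x * y)"

locale matrix_algebra_iso = assoc_algebra scale
  for scale :: "'k::field \<Rightarrow> 'a::ring_1 \<Rightarrow> 'a" +
  fixes d :: nat and \<psi> :: "'a \<Rightarrow> 'k mat"
  assumes bij: "bij_betw \<psi> UNIV (carrier_mat (d + 1) (d + 1))"
    and hom_one: "\<psi> 1 = 1\<^sub>m (d + 1)"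
    and hom_add: "\<psi> (x + y) = \<psi> x + \<psi> y"
    and hom_mult: "\<psi> (x * y) = \<psi> x * \<psi> y"
    and hom_scale: "\<psi> (scale c x) = c \<cdot>\<^sub>m \<psi> x"

locale algebra_left_module =
  Alg: assoc_algebra scaleA + Vec: vector_space scaleV
  for scaleA :: "'k::field \<Rightarrow> 'a::ring_1 \<Rightarrow> 'a"
    and scaleV :: "'k \<Rightarrow> 'v::ab_group_add \<Rightarrow> 'v" +
  fixes act :: "'a \<Rightarrow> 'v \<Rightarrow> 'v"
  assumes act_one: "act 1 v = v"
    and act_mult: "act (x * y) v = act x (act y v)"
    and act_add_left: "act (x + y) v = act x v + act y v"
    and act_add_right: "act x (v + w) = act x v + act x w"
    and act_scale_left: "act (scaleA c x) v = scaleV c (act x v)"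
    and act_scale_right: "act x (scaleV c v) = scaleV c (act x v)"

locale simple_left_module = algebra_left_module scaleA scaleV act
  for scaleA :: "'k::field \<Rightarrow> 'a::ring_1 \<Rightarrow> 'a"
    and scaleV :: "'k \<Rightarrow> 'v::ab_group_add \<Rightarrow> 'v"
    and act :: "'a \<Rightarrow> 'v \<Rightarrow> 'v" +
  assumes nonzero: "\<exists>v::'v. v \<noteq> 0"
    and simple: "Vec.subspace W \<Longrightarrow> (\<forall>x. \<forall>w\<in>W. act x w \<in> W) \<Longrightarrow> W = {0} \<or> W = UNIV"

text \<open>By Skolem-Noether the trace and the eigenvalues of an algebra element \<open>x\<close>, read off from
  the matrix \<open>\<psi> x\<close>, do not depend on the isomorphism \<open>\<psi>\<close>.\<close>

definition mat_trace :: "'k::comm_ring_1 mat \<Rightarrow> 'k" where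
  "mat_trace M = (\<Sum>i<dim_row M. M $$ (i, i))"

definition poly_in :: "('k::field \<Rightarrow> 'a::ring_1 \<Rightarrow> 'a) \<Rightarrow> 'k poly \<Rightarrow> 'a \<Rightarrow> 'a" where
  "poly_in scale p x = (\<Sum>k\<le>degree p. scale (coeff p k) (x ^ k))"

definition inverse_in :: "'a::ring_1 \<Rightarrow> 'a" where
  "inverse_in x = (THE y. x * y = 1 \<and> y * x = 1)"

definition represents ::
  "nat \<Rightarrow> ('k::field \<Rightarrow> 'v::ab_group_add \<Rightarrow> 'v) \<Rightarrow> ('a \<Rightarrow> 'v \<Rightarrow> 'v) \<Rightarrow> (nat \<Rightarrow> 'v) \<Rightarrow> 'k mat \<Rightarrow> 'a \<Rightarrow> bool"
where
  "represents d scaleV act v Y x \<longleftrightarrow>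
     Y \<in> carrier_mat (d + 1) (d + 1) \<and>
     (\<forall>j\<le>d. act x (v j) = (\<Sum>i\<le>d. scaleV (Y $$ (i, j)) (v i)))"

definition representing_matrix ::
  "nat \<Rightarrow> ('k::field \<Rightarrow> 'v::ab_group_add \<Rightarrow> 'v) \<Rightarrow> ('a \<Rightarrow> 'v \<Rightarrow> 'v) \<Rightarrow> (nat \<Rightarrow> 'v) \<Rightarrow> 'a \<Rightarrow> 'k mat"
where
  "representing_matrix d scaleV act v x = (THE Y. represents d scaleV act v Y x)"


section \<open>Leonard systems\<close>

definition multiplicity_free :: "nat \<Rightarrow> ('a \<Rightarrow> 'k::field mat) \<Rightarrow> 'a \<Rightarrow> bool" where
  "multiplicity_free d \<psi> A \<longleftrightarrow> card {t. eigenvalue (\<psi> A) t} = d + 1"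

definition primitive_idempotent ::
  "('k::field \<Rightarrow> 'a::ring_1 \<Rightarrow> 'a) \<Rightarrow> nat \<Rightarrow> 'a \<Rightarrow> (nat \<Rightarrow> 'k) \<Rightarrow> nat \<Rightarrow> 'a"
where
  "primitive_idempotent scale d A \<theta> i =
     prod_list (map (\<lambda>j. scale (1 / (\<theta> i - \<theta> j)) (A - scale (\<theta> j) 1))
                    (filter (\<lambda>j. j \<noteq> i) [0..<d + 1]))"

text \<open>\<open>E\<close> is an ordering of the primitive idempotents of \<open>A\<close>, and \<open>\<theta> i\<close> is the
  eigenvalue of \<open>A\<close> associated with \<open>E i\<close>. Sequences are functions on \<open>nat\<close>, of which only the
  values at indices up to \<open>d\<close> matter.\<close>

definition idempotent_ordering ::
  "('k::field \<Rightarrow> 'a::ring_1 \<Rightarrow> 'a) \<Rightarrow> nat \<Rightarrow> ('a \<Rightarrow> 'k mat) \<Rightarrow> 'a \<Rightarrow> (nat \<Rightarrow> 'a) \<Rightarrow> (nat \<Rightarrow> 'k) \<Rightarrow> bool"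
where
  "idempotent_ordering scale d \<psi> A E \<theta> \<longleftrightarrow>
     bij_betw \<theta> {..d} {t. eigenvalue (\<psi> A) t} \<and>
     (\<forall>i\<le>d. E i = primitive_idempotent scale d A \<theta> i)"

definition leonard_system ::
  "('k::field \<Rightarrow> 'a::ring_1 \<Rightarrow> 'a) \<Rightarrow> nat \<Rightarrow> ('a \<Rightarrow> 'k mat)
   \<Rightarrow> 'a \<Rightarrow> (nat \<Rightarrow> 'a) \<Rightarrow> 'a \<Rightarrow> (nat \<Rightarrow> 'a) \<Rightarrow> bool"
where
  "leonard_system scale d \<psi> A E As Es \<longleftrightarrow>
     multiplicity_free d \<psi> A \<and> multiplicity_free d \<psi> As \<and>
     (\<exists>\<theta>. idempotent_ordering scale d \<psi> A E \<theta>) \<and>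
     (\<exists>\<theta>s. idempotent_ordering scale d \<psi> As Es \<theta>s) \<and>
     (\<forall>i\<le>d. \<forall>j\<le>d.
        (\<bar>int i - int j\<bar> > 1 \<longrightarrow> E i * As * E j = 0 \<and> Es i * A * Es j = 0) \<and>
        (\<bar>int i - int j\<bar> = 1 \<longrightarrow> E i * As * E j \<noteq> 0 \<and> Es i * A * Es j \<noteq> 0))"

definition tau :: "(nat \<Rightarrow> 'k::field) \<Rightarrow> nat \<Rightarrow> 'k poly" where
  "tau \<theta> i = (\<Prod>h<i. [:- \<theta> h, 1:])"

definition eta :: "nat \<Rightarrow> (nat \<Rightarrow> 'k::field) \<Rightarrow> nat \<Rightarrow> 'k poly" where
  "eta d \<theta> i = (\<Prod>h<i. [:- \<theta> (d - h), 1:])"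

text \<open>The matrix representing \<open>x\<close> with respect to the basis \<open>\<tau>\<^sub>i(A) v0\<close> of the module.\<close>

definition split_matrix ::
  "nat \<Rightarrow> ('k::field \<Rightarrow> 'a::ring_1 \<Rightarrow> 'a) \<Rightarrow> ('k \<Rightarrow> 'v::ab_group_add \<Rightarrow> 'v) \<Rightarrow> ('a \<Rightarrow> 'v \<Rightarrow> 'v)
   \<Rightarrow> 'a \<Rightarrow> (nat \<Rightarrow> 'k) \<Rightarrow> 'v \<Rightarrow> 'a \<Rightarrow> 'k mat"
where
  "split_matrix d scaleA scaleV act A \<theta> v0 x =
     representing_matrix d scaleV act (\<lambda>i. act (poly_in scaleA (tau \<theta> i) A) v0) x"

text \<open>In \<open>parameter_array\<close> the sequence \<open>\<phi>1\<close> is the first split sequence (usually written with the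
  variant letter varphi) and \<open>\<phi>2\<close> the second one (usually written phi); both are indexed from 1.\<close>

definition parameter_array ::
  "('k::field \<Rightarrow> 'a::ring_1 \<Rightarrow> 'a) \<Rightarrow> nat \<Rightarrow> ('a \<Rightarrow> 'k mat)
   \<Rightarrow> 'a \<Rightarrow> (nat \<Rightarrow> 'a) \<Rightarrow> 'a \<Rightarrow> (nat \<Rightarrow> 'a)
   \<Rightarrow> (nat \<Rightarrow> 'k) \<Rightarrow> (nat \<Rightarrow> 'k) \<Rightarrow> (nat \<Rightarrow> 'k) \<Rightarrow> (nat \<Rightarrow> 'k) \<Rightarrow> bool"
where
  "parameter_array scale d \<psi> A E As Es \<theta> \<theta>s \<phi>1 \<phi>2 \<longleftrightarrow>
     idempotent_ordering scale d \<psi> A E \<theta> \<and>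
     idempotent_ordering scale d \<psi> As Es \<theta>s \<and>
     (\<forall>i\<in>{1..d}. \<phi>1 i = (\<theta>s 0 - \<theta>s i) *
        (mat_trace (\<psi> (poly_in scale (tau \<theta> i) A * Es 0)) /
         mat_trace (\<psi> (poly_in scale (tau \<theta> (i - 1)) A * Es 0)))) \<and>
     (\<forall>i\<in>{1..d}. \<phi>2 i = (\<theta>s 0 - \<theta>s i) *
        (mat_trace (\<psi> (poly_in scale (eta d \<theta> i) A * Es 0)) /
         mat_trace (\<psi> (poly_in scale (eta d \<theta> (i - 1)) A * Es 0))))"

definition is_switching_element ::
  "('k::field \<Rightarrow> 'a::ring_1 \<Rightarrow> 'a) \<Rightarrow> nat \<Rightarrow> ('a \<Rightarrow> 'k mat)
   \<Rightarrow> 'a \<Rightarrow> (nat \<Rightarrow> 'a) \<Rightarrow> 'a \<Rightarrow> (nat \<Rightarrow> 'a) \<Rightarrow> 'a \<Rightarrow> bool"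
where
  "is_switching_element scale d \<psi> A E As Es S \<longleftrightarrow>
     (\<exists>\<theta> \<theta>s \<phi>1 \<phi>2. parameter_array scale d \<psi> A E As Es \<theta> \<theta>s \<phi>1 \<phi>2 \<and>
        S = (\<Sum>r\<le>d. scale ((\<Prod>k<r. \<phi>2 (d - k)) / (\<Prod>k\<in>{1..r}. \<phi>1 k)) (E r)))"

definition is_dual_switching_element ::
  "('k::field \<Rightarrow> 'a::ring_1 \<Rightarrow> 'a) \<Rightarrow> nat \<Rightarrow> ('a \<Rightarrow> 'k mat)
   \<Rightarrow> 'a \<Rightarrow> (nat \<Rightarrow> 'a) \<Rightarrow> 'a \<Rightarrow> (nat \<Rightarrow> 'a) \<Rightarrow> 'a \<Rightarrow> bool"
where
  "is_dual_switching_element scale d \<psi> A E As Es S \<longleftrightarrow>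
     is_switching_element scale d \<psi> As Es A E S"


section \<open>The scalars \<open>[r, s, t]\<^sub>q\<close>\<close>

definition qpoch :: "'c::field \<Rightarrow> 'c \<Rightarrow> nat \<Rightarrow> 'c" where
  "qpoch a q n = (\<Prod>k<n. 1 - a * q ^ k)"

text \<open>The scalar lies in the ground field, but \<open>q\<close> may not, so it is computed in the algebraic
  closure. The final branch is the case \<open>q = 1\<close> in characteristic 2.\<close>

definition bracket :: "'k::field alg_closure \<Rightarrow> nat \<Rightarrow> nat \<Rightarrow> nat \<Rightarrow> 'k alg_closure" where
  "bracket q r s t =
    (if r = 0 \<or> s = 0 \<or> t = 0 then 1
     else if q \<noteq> 1 \<and> q \<noteq> -1 then
       (qpoch q q (r + s) * qpoch q q (r + t) * qpoch q q (s + t)) /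
       (qpoch q q r * qpoch q q s * qpoch q q t * qpoch q q (r + s + t))
     else if q = 1 \<and> CHAR('k) \<noteq> 2 then
       of_nat (fact (r + s) * fact (r + t) * fact (s + t)) /
       of_nat (fact r * fact s * fact t * fact (r + s + t))
     else if q = -1 \<and> CHAR('k) \<noteq> 2 then
       (if odd r \<and> odd s \<and> odd t then 0
        else
          of_nat (fact ((r + s) div 2) * fact ((r + t) div 2) * fact ((s + t) div 2)) /
          of_nat (fact (r div 2) * fact (s div 2) * fact (t div 2) * fact ((r + s + t) div 2)))
     else 0)"

text \<open>For \<open>d \<le> 2\<close> the condition on the eigenvalues is empty and \<open>q\<close> is any nonzero scalar.\<close>

definition base_scalar ::
  "nat \<Rightarrow> (nat \<Rightarrow> 'k::field) \<Rightarrow> (nat \<Rightarrow> 'k) \<Rightarrow> 'k alg_closure \<Rightarrow> bool"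
where
  "base_scalar d \<theta> \<theta>s q \<longleftrightarrow> q \<noteq> 0 \<and>
     (\<forall>i. 2 \<le> i \<and> i + 1 \<le> d \<longrightarrow>
        to_ac ((\<theta> (i - 2) - \<theta> (i + 1)) / (\<theta> (i - 1) - \<theta> i)) = q + inverse q + 1 \<and>
        to_ac ((\<theta>s (i - 2) - \<theta>s (i + 1)) / (\<theta>s (i - 1) - \<theta>s i)) = q + inverse q + 1)"

end

theory Submission
  imports Defs
begin

text \<open>
  Write \<open>w\<^sub>i = \<tau>\<^sub>i(A) v\<^sub>0\<close> and \<open>w'\<^sub>i = \<eta>\<^sub>i(A) v\<^sub>0\<close>. Tridiagonality of \<open>A\<close> on the eigenspaces of
  \<open>A\<^sup>*\<close> puts \<open>w\<^sub>i\<close> into \<open>E\<^sup>*\<^sub>0V + \<dots> + E\<^sup>*\<^sub>iV\<close>, and the factors of \<open>\<tau>\<^sub>i\<close> put it into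
  \<open>E\<^sub>iV + \<dots> + E\<^sub>dV\<close>. The intersection of these two spaces is a line, whence
  \<open>A\<^sup>* w\<^sub>i = \<theta>\<^sup>*\<^sub>i w\<^sub>i + \<phi>1\<^sub>i w\<^sub>i\<^sub>-\<^sub>1\<close> (lemmas \<open>b_w\<close> and \<open>split_sequence\<close>). The same argument for the
  reversed sequence of the \<open>E\<^sub>i\<close> gives \<open>A\<^sup>* w'\<^sub>i = \<theta>\<^sup>*\<^sub>i w'\<^sub>i + \<phi>2\<^sub>i w'\<^sub>i\<^sub>-\<^sub>1\<close>.

  The point of the proof is that the dual switching element \<open>S\<^sup>*\<close> maps \<open>w'\<^sub>i\<close> to
  \<open>(\<phi>2\<^sub>1 \<cdots> \<phi>2\<^sub>i) / (\<phi>1\<^sub>1 \<cdots> \<phi>1\<^sub>i) w\<^sub>i\<close> (lemmas \<open>intertwiner_on_split_vectors\<close> and \<open>dual_switch_R_w\<close>). As \<open>S\<^sup>*\<close>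
  commutes with \<open>A\<^sup>*\<close>, induction on \<open>i\<close> shows that the difference of the two vectors is an eigenvector
  of \<open>A\<^sup>*\<close> for \<open>\<theta>\<^sup>*\<^sub>i\<close>; its component in \<open>E\<^sup>*\<^sub>iV\<close> vanishes because \<open>w\<^sub>i\<close> and \<open>w'\<^sub>i\<close> have the same
  component there, so it is zero.

  Hence the columns of \<open>S\<^sup>*\<close> and of its inverse are obtained by expanding \<open>\<tau>\<^sub>j\<close> in the polynomials
  \<open>\<eta>\<^sub>i\<close> and \<open>\<eta>\<^sub>j\<close> in the polynomials \<open>\<tau>\<^sub>i\<close>. The second expansion is the first one for the reversed
  sequence of eigenvalues, so it suffices to prove
  \<open>\<tau>\<^sub>j = (\<Sum>i\<le>j. [i, j - i, d - j]\<^sub>q \<tau>\<^sub>j\<^sub>-\<^sub>i(\<theta>\<^sub>d) \<eta>\<^sub>i)\<close> (lemma \<open>connection_eq_bracket\<close>). Multiplying by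
  \<open>\<lambda> - \<theta>\<^sub>j\<close> turns this into a recurrence for the brackets, in which the eigenvalues enter through the
  ratio of two differences \<open>\<theta>\<^sub>m - \<theta>\<^sub>k\<close> with the same index sum \<open>m + k\<close>. Such ratios depend on \<open>q\<close> and
  the indices only (lemma \<open>bracket_recurrence_holds\<close>). They are computed from the closed forms of the
  sequence for generic \<open>q\<close>, \<open>q = 1\<close> and \<open>q = -1\<close>; in characteristic 2 with \<open>q = 1\<close> the distinctness
  of the eigenvalues leaves only \<open>d \<le> 3\<close>.

  Two points connect this with the definitions. The switching element of the dual system is given by
  the split sequences of that system, which are computed in the bases \<open>w\<close> and \<open>w'\<close>
  (lemma \<open>dual_split_sequences\<close>). And traces in the matrix algebra become scalars on the module
  through \<open>E\<^sub>i X E\<^sub>i = tr(X E\<^sub>i) E\<^sub>i\<close> (lemma \<open>idempotent_sandwich\<close>).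
\<close>

section \<open>Newton polynomials and their connection coefficients\<close>

lemma tau_0 [simp]: "tau \<theta> 0 = 1" by (simp add: tau_def)

lemma tau_Suc: "tau \<theta> (Suc i) = tau \<theta> i * [:- \<theta> i, 1:]" by (simp add: tau_def)

lemma eta_eq_tau: "eta d \<theta> i = tau (\<lambda>h. \<theta> (d - h)) i" by (simp add: eta_def tau_def)

lemma tau_cong: "(\<And>h. h < i \<Longrightarrow> \<theta> h = \<theta>' h) \<Longrightarrow> tau \<theta> i = tau \<theta>' i"
  by (simp add: tau_def)

lemma poly_tau_eq_0: "j < i \<Longrightarrow> poly (tau \<theta> i) (\<theta> j) = 0"
  by (auto simp: tau_def poly_prod)

lemma poly_tau_nonzero: "inj_on \<theta> {..d} \<Longrightarrow> i \<le> j \<Longrightarrow> j \<le> d \<Longrightarrow> poly (tau \<theta> i) (\<theta> j) \<noteq> 0"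
  by (auto simp: tau_def poly_prod inj_on_eq_iff)

text \<open>
  The coefficient of \<open>\<eta>\<^sub>i\<close> in \<open>\<tau>\<^sub>j\<close>. The recursion comes from
  \<open>(\<lambda> - \<theta>\<^sub>j) \<eta>\<^sub>i = \<eta>\<^sub>i\<^sub>+\<^sub>1 + (\<theta>\<^sub>d\<^sub>-\<^sub>i - \<theta>\<^sub>j) \<eta>\<^sub>i\<close>. Defining it over the ground field, rather than as the
  expression in brackets that it equals, keeps the algebraic closure out of the linear algebra.
\<close>
fun connection :: "nat \<Rightarrow> (nat \<Rightarrow> 'k::field) \<Rightarrow> nat \<Rightarrow> nat \<Rightarrow> 'k" where
  "connection d \<theta> 0 i = (if i = 0 then 1 else 0)"
| "connection d \<theta> (Suc j) i =
     (if i = 0 then 0 else connection d \<theta> j (i - 1)) + (\<theta> (d - i) - \<theta> j) * connection d \<theta> j i"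

lemma connection_eq_0: "j < i \<Longrightarrow> connection d \<theta> j i = 0"
  by (induction j arbitrary: i) auto

lemma tau_eq_sum_eta: "tau \<theta> j = (\<Sum>i\<le>j. smult (connection d \<theta> j i) (eta d \<theta> i))"
proof (induction j)
  case (Suc j)
  let ?c = "connection d \<theta> j" and ?e = "eta d \<theta>"
  have step: "?e i * [:- \<theta> j, 1:] = ?e (Suc i) + smult (\<theta> (d - i) - \<theta> j) (?e i)" for i
  proof -
    have "[:- \<theta> j, 1:] = [:- \<theta> (d - i), 1:] + [:\<theta> (d - i) - \<theta> j:]" by simp
    then show ?thesis
      by (simp only: eta_eq_tau tau_Suc distrib_left) simp
  qed
  have "tau \<theta> (Suc j) = (\<Sum>i\<le>j. smult (?c i) (?e i * [:- \<theta> j, 1:]))"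
    unfolding tau_Suc Suc.IH by (simp only: sum_distrib_right mult_smult_left)
  also have "\<dots> = (\<Sum>i\<le>j. smult (?c i) (?e (Suc i))) +
      (\<Sum>i\<le>j. smult ((\<theta> (d - i) - \<theta> j) * ?c i) (?e i))"
    unfolding step by (simp add: smult_add_right sum.distrib mult.commute)
  also have "(\<Sum>i\<le>j. smult (?c i) (?e (Suc i))) =
      (\<Sum>i\<le>Suc j. smult (if i = 0 then 0 else ?c (i - 1)) (?e i))"
    by (subst sum.atMost_Suc_shift) simp
  also have "(\<Sum>i\<le>j. smult ((\<theta> (d - i) - \<theta> j) * ?c i) (?e i)) =
      (\<Sum>i\<le>Suc j. smult ((\<theta> (d - i) - \<theta> j) * ?c i) (?e i))"
    by (simp add: connection_eq_0)
  finally show ?case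
    by (simp only: connection.simps smult_add_left sum.distrib)
qed (simp add: eta_def)

section \<open>Sequences of eigenvalues\<close>

text \<open>
  With \<open>c = q + 1/q + 1\<close> this is the condition on the eigenvalues that defines \<open>q\<close>, cleared of
  denominators.
\<close>
definition three_term :: "nat \<Rightarrow> 'c::field \<Rightarrow> (nat \<Rightarrow> 'c) \<Rightarrow> bool" where
  "three_term d c x \<longleftrightarrow> (\<forall>i. i + 3 \<le> d \<longrightarrow> x i - x (i + 3) = c * (x (i + 1) - x (i + 2)))"

lemma three_term_unique:
  assumes x: "three_term d c x" and y: "three_term d c y"
    and "x 0 = y 0" "x 1 = y 1" "x 2 = y 2" and "m \<le> d"
  shows "x m = y m"
  using \<open>m \<le> d\<close>
proof (induction m rule: less_induct)
  case (less m)
  show ?case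
  proof (cases "m < 3")
    case True
    then have "m = 0 \<or> m = 1 \<or> m = 2" by arith
    with assms(3-5) show ?thesis by auto
  next
    case False
    then obtain i where m: "m = i + 3"
      by (metis add.commute le_Suc_ex not_less)
    have "x i = y i" "x (i + 1) = y (i + 1)" "x (i + 2) = y (i + 2)"
      using less m by simp_all
    moreover have "x m = x i - c * (x (i + 1) - x (i + 2))" "y m = y i - c * (y (i + 1) - y (i + 2))"
      using x y less.prems unfolding three_term_def m by (auto simp: algebra_simps)
    ultimately show ?thesis by simp
  qed
qed

text \<open>
  The characteristic polynomial of the recurrence has the roots \<open>1\<close>, \<open>q\<close> and \<open>1/q\<close>, which are distinct
  here; in the two lemmas that follow some of them collide, and the powers are replaced by
  polynomial multiples. In each case three parameters fit the three initial values.
\<close>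
lemma closed_form_generic:
  fixes q :: "'c::field"
  assumes "q \<noteq> 0" "q \<noteq> 1" "q \<noteq> -1" and x: "three_term d (q + inverse q + 1) x"
  obtains \<alpha> \<beta> \<gamma> where "\<And>m. m \<le> d \<Longrightarrow> x m = \<alpha> + \<beta> * q ^ m + \<gamma> * inverse q ^ m"
proof -
  define u where "u = x 1 - x 0"
  define v where "v = x 2 - x 1"
  define p where "p = inverse q"
  have qp: "q * p = 1" using assms(1) by (simp add: p_def)
  have q2: "q * q \<noteq> 1" using assms(2,3) by (metis square_eq_1_iff)
  have pq: "q - p \<noteq> 0" using q2 qp assms(1) by auto
  have p1: "p - 1 \<noteq> 0" using assms(2) qp by auto
  have q1: "q - 1 \<noteq> 0" using assms(2) by auto
  define P where "P = (v - p * u) / (q - p)"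
  define R where "R = (q * u - v) / (q - p)"
  define \<beta> where "\<beta> = P / (q - 1)"
  define \<gamma> where "\<gamma> = R / (p - 1)"
  define y where "y m = (x 0 - \<beta> - \<gamma>) + \<beta> * q ^ m + \<gamma> * p ^ m" for m
  have PR1: "P + R = u"
    unfolding P_def R_def using pq by (simp add: divide_simps) (simp add: algebra_simps)
  have PR2: "q * P + p * R = v"
  proof -
    have "q * P + p * R = (q * (v - p * u) + p * (q * u - v)) / (q - p)"
      unfolding P_def R_def by (simp add: add_divide_distrib)
    also have "q * (v - p * u) + p * (q * u - v) = v * (q - p)"
      by (simp add: algebra_simps)
    finally show ?thesis using pq by simp
  qed
  have bP: "\<beta> * (q - 1) = P" and gR: "\<gamma> * (p - 1) = R"
    using q1 p1 by (simp_all add: \<beta>_def \<gamma>_def)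
  have y0: "x 0 = y 0" by (simp add: y_def)
  have "y 1 - y 0 = \<beta> * (q - 1) + \<gamma> * (p - 1)"
    by (simp add: y_def algebra_simps)
  then have "y 1 - y 0 = x 1 - x 0"
    unfolding bP gR PR1 u_def .
  then have y1: "x 1 = y 1"
    using y0 by simp
  have "y 2 - y 1 = q * (\<beta> * (q - 1)) + p * (\<gamma> * (p - 1))"
    by (simp add: y_def algebra_simps power2_eq_square)
  then have "y 2 - y 1 = x 2 - x 1"
    unfolding bP gR PR2 v_def .
  then have y2: "x 2 = y 2"
    using y1 by simp
  have "y i - y (i + 3) = (q + p + 1) * (y (i + 1) - y (i + 2))" for i
  proof -
    have 1: "(q + p + 1) * (q - q * q) = 1 - q * q * q"
    proof -
      have "(q + p + 1) * (q - q * q) = q * p * (1 - q) + q - q * q * q"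
        by (simp add: algebra_simps)
      then show ?thesis unfolding qp by simp
    qed
    have 2: "(q + p + 1) * (p - p * p) = 1 - p * p * p"
    proof -
      have "(q + p + 1) * (p - p * p) = q * p * (1 - p) + p - p * p * p"
        by (simp add: algebra_simps)
      then show ?thesis unfolding qp by simp
    qed
    have "y i - y (i + 3) = \<beta> * q ^ i * (1 - q * q * q) + \<gamma> * p ^ i * (1 - p * p * p)"
      by (simp add: y_def algebra_simps power3_eq_cube power_add)
    also have "\<dots> = (q + p + 1) * (\<beta> * q ^ i * (q - q * q) + \<gamma> * p ^ i * (p - p * p))"
      unfolding 1[symmetric] 2[symmetric] by (simp add: algebra_simps)
    also have "\<dots> = (q + p + 1) * (y (i + 1) - y (i + 2))"
      by (simp add: y_def algebra_simps power2_eq_square power_add)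
    finally show ?thesis .
  qed
  then have "three_term d (q + inverse q + 1) y"
    by (simp add: three_term_def p_def)
  then have "x m = (x 0 - \<beta> - \<gamma>) + \<beta> * q ^ m + \<gamma> * inverse q ^ m" if "m \<le> d" for m
    using three_term_unique[OF x _ y0 y1 y2 that] unfolding y_def p_def by blast
  then show ?thesis by (rule that)
qed

text \<open>
  The binomial coefficient in place of a square makes this form valid in every characteristic.
\<close>
lemma closed_form_one:
  fixes x :: "nat \<Rightarrow> 'c::field"
  assumes x: "three_term d 3 x"
  obtains \<alpha> \<beta> \<gamma>
  where "\<And>m. m \<le> d \<Longrightarrow> x m = \<alpha> + \<beta> * of_nat m + \<gamma> * of_nat (m choose 2)"
proof -
  define \<beta> where "\<beta> = x 1 - x 0"
  define \<gamma> where "\<gamma> = x 2 - 2 * x 1 + x 0"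
  define y where "y m = x 0 + \<beta> * of_nat m + \<gamma> * of_nat (m choose 2)" for m
  have c: "(Suc k choose 2) = (k choose 2) + k" for k
    by (simp add: numeral_2_eq_2)
  have "y i - y (i + 3) = 3 * (y (i + 1) - y (i + 2))" for i
    by (simp add: y_def c numeral_3_eq_3 algebra_simps)
  then have "three_term d 3 y"
    by (simp add: three_term_def)
  moreover have "x 0 = y 0" "x 1 = y 1" "x 2 = y 2"
    by (simp_all add: y_def \<beta>_def \<gamma>_def binomial_eq_0)
  ultimately have "x m = x 0 + \<beta> * of_nat m + \<gamma> * of_nat (m choose 2)" if "m \<le> d" for m
    using three_term_unique[OF x] that unfolding y_def by blast
  then show ?thesis by (rule that)
qed

lemma closed_form_minus_one:
  fixes x :: "nat \<Rightarrow> 'c::field"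
  assumes x: "three_term d (-1) x" and two: "(2::'c) \<noteq> 0"
  obtains \<alpha> \<beta> \<gamma>
  where "\<And>m. m \<le> d \<Longrightarrow> x m = \<alpha> + (-1) ^ m * (\<beta> + \<gamma> * of_nat m)"
proof -
  define \<gamma> where "\<gamma> = (x 2 - x 0) / 2"
  define \<beta> where "\<beta> = (x 0 - x 1 - \<gamma>) / 2"
  have g: "2 * \<gamma> = x 2 - x 0" and b: "2 * \<beta> = x 0 - x 1 - \<gamma>"
    using two by (simp_all add: \<gamma>_def \<beta>_def)
  define y where "y m = (x 0 - \<beta>) + (-1) ^ m * (\<beta> + \<gamma> * of_nat m)" for m
  have "y i - y (i + 3) = - (y (i + 1) - y (i + 2))" for i
    by (simp add: y_def power_add) (simp add: algebra_simps)
  then have "three_term d (-1) y"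
    by (simp add: three_term_def)
  moreover have "x 0 = y 0" by (simp add: y_def)
  moreover have "x 1 = y 1"
  proof -
    have "y 1 = x 0 - 2 * \<beta> - \<gamma>" by (simp add: y_def)
    then show ?thesis by (simp add: b)
  qed
  moreover have "x 2 = y 2"
  proof -
    have "y 2 = x 0 + 2 * \<gamma>" by (simp add: y_def)
    then show ?thesis by (simp add: g)
  qed
  ultimately have "x m = (x 0 - \<beta>) + (-1) ^ m * (\<beta> + \<gamma> * of_nat m)" if "m \<le> d" for m
    using three_term_unique[OF x] that unfolding y_def by blast
  then show ?thesis by (rule that)
qed

text \<open>
  Reversing the eigenvalues exchanges \<open>\<tau>\<close> and \<open>\<eta>\<close>; this is how the inverse of the switching element
  is reduced to the same polynomial identity as the switching element itself.
\<close>
lemma three_term_reverse: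
  assumes "three_term d c x"
  shows "three_term d c (\<lambda>m. x (d - m))"
  unfolding three_term_def
proof (intro allI impI)
  fix i assume i: "i + 3 \<le> d"
  define k where "k = d - (i + 3)"
  have "d - i = k + 3" "d - (i + 1) = k + 2" "d - (i + 2) = k + 1" "d - (i + 3) = k" "k + 3 \<le> d"
    using i by (simp_all add: k_def)
  with assms have "x k - x (k + 3) = c * (x (k + 1) - x (k + 2))" by (simp add: three_term_def)
  then have "- (x k - x (k + 3)) = - (c * (x (k + 1) - x (k + 2)))" by simp
  then show "x (d - i) - x (d - (i + 3)) = c * (x (d - (i + 1)) - x (d - (i + 2)))"
    unfolding \<open>d - i = _\<close> \<open>d - (i + 1) = _\<close> \<open>d - (i + 2) = _\<close> \<open>d - (i + 3) = _\<close>
    by (simp add: algebra_simps)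
qed

lemma base_scalar_three_term:
  assumes q: "base_scalar d \<theta> \<theta>s q" and inj: "inj_on \<theta> {..d}"
  shows "q \<noteq> 0" "three_term d (q + inverse q + 1) (\<lambda>i. to_ac (\<theta> i))"
proof -
  show "q \<noteq> 0" using q by (simp add: base_scalar_def)
  show "three_term d (q + inverse q + 1) (\<lambda>i. to_ac (\<theta> i))"
    unfolding three_term_def
  proof (intro allI impI)
    fix i assume i: "i + 3 \<le> d"
    have "\<theta> (i + 1) \<noteq> \<theta> (i + 2)" using inj i by (auto dest: inj_onD)
    moreover have "to_ac ((\<theta> i - \<theta> (i + 3)) / (\<theta> (i + 1) - \<theta> (i + 2))) = q + inverse q + 1"
    proof -
      have "i + 2 - 2 = i" "i + 2 + 1 = i + 3" "i + 2 - 1 = i + 1" by simp_all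
      moreover have "2 \<le> i + 2" "i + 2 + 1 \<le> d" using i by simp_all
      ultimately show ?thesis using q unfolding base_scalar_def by metis
    qed
    ultimately show "to_ac (\<theta> i) - to_ac (\<theta> (i + 3)) =
        (q + inverse q + 1) * (to_ac (\<theta> (i + 1)) - to_ac (\<theta> (i + 2)))"
      by (simp add: divide_eq_eq)
  qed
qed

section \<open>The recurrence of the brackets\<close>

text \<open>
  The common shape of the brackets: \<open>F n\<close> is \<open>(q;q)\<^sub>n\<close> for generic \<open>q\<close>, \<open>n!\<close> for \<open>q = 1\<close> and
  \<open>\<lfloor>n/2\<rfloor>!\<close> for \<open>q = -1\<close>.
\<close>
definition factorial_quotient :: "(nat \<Rightarrow> 'c::field) \<Rightarrow> nat \<Rightarrow> nat \<Rightarrow> nat \<Rightarrow> 'c" where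
  "factorial_quotient F r s t =
     F (r + s) * F (r + t) * F (s + t) / (F r * F s * F t * F (r + s + t))"

text \<open>
  All three quotients share the factor \<open>K\<close>, so a linear relation between them reduces to a relation
  between products of two values of \<open>g\<close>, and no division remains.
\<close>
lemma factorial_quotient_neighbours:
  fixes F g :: "nat \<Rightarrow> 'c::field"
  assumes F: "\<And>n. F (Suc n) = F n * g (Suc n)" and nz: "\<And>n. n \<le> r + s + t + 2 \<Longrightarrow> F n \<noteq> 0"
  obtains K where
    "factorial_quotient F (Suc r) (Suc s) t = K * (g (r + s + 2) * g (t + 1))"
    "factorial_quotient F r (Suc s) (Suc t) = K * (g (s + t + 2) * g (r + 1))"
    "factorial_quotient F (Suc r) s (Suc t) = K * (g (r + t + 2) * g (s + 1))"
proof -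
  define K where "K = F (r + s + 1) * F (r + t + 1) * F (s + t + 1) /
    (F (r + 1) * F (s + 1) * F (t + 1) * F (r + s + t + 2))"
  have n: "F r \<noteq> 0" "F s \<noteq> 0" "F t \<noteq> 0" "F (r + s + t + 2) \<noteq> 0"
    "g (Suc r) \<noteq> 0" "g (Suc s) \<noteq> 0" "g (Suc t) \<noteq> 0"
    using nz[of r] nz[of s] nz[of t] nz[of "r + s + t + 2"]
      nz[of "Suc r"] nz[of "Suc s"] nz[of "Suc t"] by (auto simp: F)
  have e: "Suc r + Suc s = Suc (Suc (r + s))" "Suc r + t = Suc (r + t)" "Suc s + t = Suc (s + t)"
    "r + Suc s = Suc (r + s)" "r + Suc t = Suc (r + t)" "Suc s + Suc t = Suc (Suc (s + t))"
    "Suc r + s = Suc (r + s)" "Suc r + Suc t = Suc (Suc (r + t))" "s + Suc t = Suc (s + t)"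
    "Suc (r + s) + Suc t = r + s + t + 2" "Suc (Suc (r + s)) + t = r + s + t + 2"
    "r + s + 1 = Suc (r + s)" "r + t + 1 = Suc (r + t)" "s + t + 1 = Suc (s + t)"
    "r + s + 2 = Suc (Suc (r + s))" "r + t + 2 = Suc (Suc (r + t))" "s + t + 2 = Suc (Suc (s + t))"
    "r + 1 = Suc r" "s + 1 = Suc s" "t + 1 = Suc t"
    by simp_all
  show ?thesis
  proof (rule that[of K])
    show "factorial_quotient F (Suc r) (Suc s) t = K * (g (r + s + 2) * g (t + 1))"
      unfolding factorial_quotient_def K_def e F using n by (simp add: divide_simps)
    show "factorial_quotient F r (Suc s) (Suc t) = K * (g (s + t + 2) * g (r + 1))"
      unfolding factorial_quotient_def K_def e F using n by (simp add: divide_simps)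
    show "factorial_quotient F (Suc r) s (Suc t) = K * (g (r + t + 2) * g (s + 1))"
      unfolding factorial_quotient_def K_def e F using n by (simp add: divide_simps)
  qed
qed

text \<open>
  The recurrence \<open>c\<^sub>i\<^sub>,\<^sub>j\<^sub>+\<^sub>1 = c\<^sub>i\<^sub>-\<^sub>1\<^sub>,\<^sub>j + (\<theta>\<^sub>d\<^sub>-\<^sub>i - \<theta>\<^sub>j) c\<^sub>i\<^sub>,\<^sub>j\<close> of the connection coefficients, for
  \<open>c\<^sub>i\<^sub>,\<^sub>j = [i, j - i, d - j] \<tau>\<^sub>j\<^sub>-\<^sub>i(\<theta>\<^sub>d)\<close>, \<open>i = r + 1\<close>, \<open>j = r + s + 1\<close> and \<open>d = r + s + t + 2\<close>, after the
  common factor \<open>\<tau>\<^sub>s(\<theta>\<^sub>d)\<close> has been cancelled.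
\<close>
definition bracket_recurrence :: "'k::field alg_closure \<Rightarrow> nat \<Rightarrow> nat \<Rightarrow> nat \<Rightarrow> (nat \<Rightarrow> 'k alg_closure) \<Rightarrow> bool"
where
  "bracket_recurrence q r s t x \<longleftrightarrow>
    (x (r + s + t + 2) - x s) * (bracket q (Suc r) (Suc s) t - bracket q r (Suc s) (Suc t)) =
    (x (s + t + 1) - x (r + s + 1)) * bracket q (Suc r) s (Suc t)"

text \<open>
  Both differences of eigenvalues have index sum \<open>d + s\<close>, so in the closed form they share a factor
  (\<open>W\<close> below) and the ratio of the second to the first is \<open>(q\<^sup>t\<^sup>+\<^sup>1 - q\<^sup>r\<^sup>+\<^sup>1) / (q\<^sup>r\<^sup>+\<^sup>t\<^sup>+\<^sup>2 - 1)\<close>. The eigenvalues being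
  distinct forces \<open>q\<^sup>n \<noteq> 1\<close> for \<open>1 \<le> n \<le> d\<close>, so that no denominator vanishes.
\<close>
lemma bracket_recurrence_generic:
  fixes q :: "'k::field alg_closure"
  assumes q: "q \<noteq> 0" "q \<noteq> 1" "q \<noteq> -1"
    and x: "three_term d (q + inverse q + 1) x" and inj: "inj_on x {..d}" and d: "d = r + s + t + 2"
  shows "bracket_recurrence q r s t x"
proof -
  define p where "p = inverse q"
  have qp: "q * p = 1" using q by (simp add: p_def)
  obtain \<alpha> \<beta> \<gamma> where cf: "\<And>m. m \<le> d \<Longrightarrow> x m = \<alpha> + \<beta> * q ^ m + \<gamma> * p ^ m"
    using closed_form_generic[OF q x] unfolding p_def by blast
  have nz: "q ^ n \<noteq> 1" if "n \<in> {1..d}" for n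
  proof
    assume qn: "q ^ n = 1"
    then have "p ^ n = 1" using qp by (metis mult_1 power_mult_distrib power_one)
    with qn have "x n = x 0" using cf[of n] cf[of 0] that by simp
    with inj that show False by (auto dest: inj_onD)
  qed
  have pochn: "qpoch q q n \<noteq> 0" if "n \<le> d" for n
    unfolding qpoch_def using that nz[of "Suc _"] by (auto simp: Suc_le_eq)
  have poch_Suc: "qpoch q q (Suc n) = qpoch q q n * (1 - q ^ Suc n)" for n
    by (simp add: qpoch_def)
  have br: "bracket q r' s' t' = factorial_quotient (qpoch q q) r' s' t'" if "r' + s' + t' \<le> d" for r' s' t'
    using q pochn[of r'] pochn[of s'] pochn[of t'] pochn[of "r' + s' + t'"]
      pochn[of "r' + s'"] pochn[of "r' + t'"] pochn[of "s' + t'"] that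
    by (auto simp: bracket_def factorial_quotient_def qpoch_def)
  obtain K where K:
    "factorial_quotient (qpoch q q) (Suc r) (Suc s) t = K * ((1 - q ^ (r + s + 2)) * (1 - q ^ (t + 1)))"
    "factorial_quotient (qpoch q q) r (Suc s) (Suc t) = K * ((1 - q ^ (s + t + 2)) * (1 - q ^ (r + 1)))"
    "factorial_quotient (qpoch q q) (Suc r) s (Suc t) = K * ((1 - q ^ (r + t + 2)) * (1 - q ^ (s + 1)))"
    using factorial_quotient_neighbours[of "qpoch q q" "\<lambda>n. 1 - q ^ n", OF poch_Suc] pochn d by metis
  define a b c where "a = q ^ (r + 1)" and "b = q ^ s" and "c = q ^ (t + 1)"
  define a' b' c' where "a' = p ^ (r + 1)" and "b' = p ^ s" and "c' = p ^ (t + 1)"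
  have aa: "a * a' = 1" "b * b' = 1" "c * c' = 1"
    unfolding a_def a'_def b_def b'_def c_def c'_def
    by (simp_all only: qp power_one flip: power_mult_distrib)
  have pows: "q ^ (r + s + 2) = a * b * q" "q ^ (s + t + 2) = b * c * q" "q ^ (r + t + 2) = a * c"
    "q ^ (s + 1) = b * q" "q ^ (r + s + t + 2) = a * b * c"
    "p ^ (r + s + t + 2) = a' * b' * c'" "q ^ (r + s + 1) = a * b" "q ^ (s + t + 1) = b * c"
    "p ^ (r + s + 1) = a' * b'" "p ^ (s + t + 1) = b' * c'"
    by (simp_all add: a_def b_def c_def a'_def b'_def c'_def power_add power2_eq_square)
  define W where "W = b * (\<beta> - \<gamma> * a' * c' * b' * b')"
  have 1: "x (r + s + t + 2) - x s = (a * c - 1) * W"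
  proof -
    have "x (r + s + t + 2) - x s = \<beta> * (a * b * c - b) + \<gamma> * (a' * b' * c' - b')"
      using cf[of "r + s + t + 2"] cf[of s] d
      by (simp only: pows) (simp add: b_def b'_def algebra_simps)
    also have "a' * b' * c' - b' = - ((a * c - 1) * (b * (a' * c' * b' * b')))"
    proof -
      have "(a * c - 1) * (b * (a' * c' * b' * b')) =
        (a * a') * (b * b') * (c * c') * b' - (b * b') * (a' * b' * c')" by (simp add: algebra_simps)
      then show ?thesis unfolding aa by simp
    qed
    finally show ?thesis by (simp add: W_def algebra_simps)
  qed
  have 2: "x (s + t + 1) - x (r + s + 1) = (c - a) * W"
  proof -
    have "x (s + t + 1) - x (r + s + 1) = \<beta> * (b * c - a * b) + \<gamma> * (b' * c' - a' * b')"
      using cf[of "s + t + 1"] cf[of "r + s + 1"] d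
      by (simp only: pows) (simp add: algebra_simps)
    also have "b' * c' - a' * b' = - ((c - a) * (b * (a' * c' * b' * b')))"
    proof -
      have "(c - a) * (b * (a' * c' * b' * b')) =
        (b * b') * (c * c') * (a' * b') - (a * a') * (b * b') * (b' * c')" by (simp add: algebra_simps)
      then show ?thesis unfolding aa by simp
    qed
    finally show ?thesis by (simp add: W_def algebra_simps)
  qed
  have "bracket q (Suc r) (Suc s) t - bracket q r (Suc s) (Suc t)
      = K * ((1 - a * b * q) * (1 - c) - (1 - b * c * q) * (1 - a))"
    using br[of "Suc r" "Suc s" t, unfolded K(1) pows, folded c_def]
      br[of r "Suc s" "Suc t", unfolded K(2) pows, folded a_def] d
    by (simp add: algebra_simps)
  also have "\<dots> = K * ((a - c) * (1 - b * q))"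
    by (simp add: algebra_simps)
  finally have 3: "bracket q (Suc r) (Suc s) t - bracket q r (Suc s) (Suc t)
     = K * ((a - c) * (1 - b * q))" .
  have 4: "bracket q (Suc r) s (Suc t) = K * ((1 - a * c) * (1 - b * q))"
    using br[of "Suc r" s "Suc t"] d K(3) pows by simp
  show ?thesis
    unfolding bracket_recurrence_def 1 2 3 4 by (simp add: algebra_simps)
qed

text \<open>
  The closed form contains a binomial coefficient, so the differences are doubled to expose their
  common factor \<open>W\<close>. Distinctness of the eigenvalues forces the characteristic to be \<open>0\<close> or greater
  than \<open>d\<close>.
\<close>
lemma bracket_recurrence_one:
  fixes x :: "nat \<Rightarrow> 'k::field alg_closure"
  assumes two: "(2::'k alg_closure) \<noteq> 0" and char: "CHAR('k) \<noteq> 2"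
    and x: "three_term d 3 x" and inj: "inj_on x {..d}" and d: "d = r + s + t + 2"
  shows "bracket_recurrence 1 r s t x"
proof -
  obtain \<alpha> \<beta> \<gamma> where cf: "\<And>m. m \<le> d \<Longrightarrow> x m = \<alpha> + \<beta> * of_nat m + \<gamma> * of_nat (m choose 2)"
    using closed_form_one[OF x] by blast
  have ch: "2 * of_nat (m choose 2) = (of_nat m * (of_nat m - 1) :: 'k alg_closure)" for m
  proof -
    have "2 * (m choose 2) + m = m * m"
      by (induction m) (simp_all add: numeral_2_eq_2)
    then have "of_nat (2 * (m choose 2) + m) = (of_nat (m * m) :: 'k alg_closure)" by simp
    then show ?thesis by (simp add: algebra_simps)
  qed
  have diff: "2 * (x m - x k) =
      (of_nat m - of_nat k) * (2 * \<beta> + \<gamma> * (of_nat m + of_nat k - 1))" if "m \<le> d" "k \<le> d" for m k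
  proof -
    have "2 * (x m - x k) = 2 * \<beta> * (of_nat m - of_nat k)
        + \<gamma> * (2 * of_nat (m choose 2) - 2 * of_nat (k choose 2))"
      using that by (simp add: cf algebra_simps)
    also have "\<dots> = (of_nat m - of_nat k) * (2 * \<beta> + \<gamma> * (of_nat m + of_nat k - 1))"
      unfolding ch by (simp add: algebra_simps)
    finally show ?thesis .
  qed
  have nz: "(of_nat n :: 'k alg_closure) \<noteq> 0" if "n \<in> {1..d}" for n
  proof
    assume "(of_nat n :: 'k alg_closure) = 0"
    then have "x n = x 0" using diff[of n 0] two that by simp
    with inj that show False by (auto dest: inj_onD)
  qed
  define F where "F n = (of_nat (fact n) :: 'k alg_closure)" for n
  have F_Suc: "F (Suc n) = F n * of_nat (Suc n)" for n
    by (simp add: F_def algebra_simps)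
  have Fnz: "F n \<noteq> 0" if "n \<le> d" for n
    using that
  proof (induction n)
    case (Suc n)
    with nz[of "Suc n"] show ?case unfolding F_Suc by simp
  qed (simp add: F_def)
  have br: "bracket 1 r' s' t' = factorial_quotient F r' s' t'" if "r' + s' + t' \<le> d" for r' s' t'
    using char Fnz[of r'] Fnz[of s'] Fnz[of t'] Fnz[of "r' + s' + t'"]
      Fnz[of "r' + s'"] Fnz[of "r' + t'"] Fnz[of "s' + t'"] that
    by (auto simp: bracket_def factorial_quotient_def F_def)
  obtain K where K:
    "factorial_quotient F (Suc r) (Suc s) t = K * (of_nat (r + s + 2) * of_nat (t + 1))"
    "factorial_quotient F r (Suc s) (Suc t) = K * (of_nat (s + t + 2) * of_nat (r + 1))"
    "factorial_quotient F (Suc r) s (Suc t) = K * (of_nat (r + t + 2) * of_nat (s + 1))"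
    using factorial_quotient_neighbours[of F of_nat, OF F_Suc] Fnz d by metis
  define R S T :: "'k alg_closure" where "R = of_nat r" and "S = of_nat s" and "T = of_nat t"
  define W where "W = 2 * \<beta> + \<gamma> * (R + 2 * S + T + 1)"
  have 1: "2 * (x (r + s + t + 2) - x s) = (R + T + 2) * W"
    using diff[of "r + s + t + 2" s] d by (simp add: W_def R_def S_def T_def algebra_simps)
  have 2: "2 * (x (s + t + 1) - x (r + s + 1)) = (T - R) * W"
    using diff[of "s + t + 1" "r + s + 1"] d by (simp add: W_def R_def S_def T_def algebra_simps)
  have 3: "bracket 1 (Suc r) (Suc s) t - bracket 1 r (Suc s) (Suc t) = K * ((T - R) * (S + 1))"
    using br[of "Suc r" "Suc s" t] br[of r "Suc s" "Suc t"] d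
    by (simp add: K R_def S_def T_def algebra_simps)
  have 4: "bracket 1 (Suc r) s (Suc t) = K * ((R + T + 2) * (S + 1))"
    using br[of "Suc r" s "Suc t"] d by (simp add: K R_def S_def T_def algebra_simps)
  have "2 * (x (r + s + t + 2) - x s) * (bracket 1 (Suc r) (Suc s) t - bracket 1 r (Suc s) (Suc t))
     = 2 * (x (s + t + 1) - x (r + s + 1)) * bracket 1 (Suc r) s (Suc t)"
    unfolding 1 2 3 4 by simp
  then show ?thesis
    unfolding bracket_recurrence_def mult.assoc using two by (simp only: mult_cancel_left) simp
qed

text \<open>
  Up to sign, a difference \<open>x\<^sub>m - x\<^sub>k\<close> is a multiple of \<open>m - k\<close> by a constant if \<open>m + k\<close> is even, and
  a function of \<open>m + k\<close> alone if \<open>m + k\<close> is odd. Accordingly the proof splits on the parity of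
  \<open>r + t\<close>. Where one of the brackets has three odd entries, the relation relies on its being zero.
\<close>
lemma bracket_recurrence_minus_one:
  fixes x :: "nat \<Rightarrow> 'k::field alg_closure"
  assumes two: "(2::'k alg_closure) \<noteq> 0" and char: "CHAR('k) \<noteq> 2"
    and x: "three_term d (-1) x" and inj: "inj_on x {..d}" and d: "d = r + s + t + 2"
  shows "bracket_recurrence (-1) r s t x"
proof -
  obtain \<alpha> \<beta> \<gamma> where cf: "\<And>m. m \<le> d \<Longrightarrow> x m = \<alpha> + (-1) ^ m * (\<beta> + \<gamma> * of_nat m)"
    using closed_form_minus_one[OF x two] by blast
  have even_diff: "x m - x k = (-1) ^ m * (\<gamma> * (of_nat m - of_nat k))"
    if "even (m + k)" "m \<le> d" "k \<le> d" for m k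
    using that by (cases "even m") (simp_all add: cf algebra_simps)
  have odd_diff: "x m - x k = (-1) ^ m * (2 * \<beta> + \<gamma> * (of_nat m + of_nat k))"
    if "odd (m + k)" "m \<le> d" "k \<le> d" for m k
    using that by (cases "even m") (simp_all add: cf algebra_simps)
  have nz: "(of_nat n :: 'k alg_closure) \<noteq> 0" if "2 * n \<in> {1..d}" for n
  proof
    assume "(of_nat n :: 'k alg_closure) = 0"
    then have "x (2 * n) = x 0" using even_diff[of "2 * n" 0] that by simp
    with inj that show False by (force dest: inj_onD)
  qed
  define F where "F n = (of_nat (fact (n div 2)) :: 'k alg_closure)" for n
  define g where "g n = (if even n then of_nat (n div 2) else 1 :: 'k alg_closure)" for n
  have F_Suc: "F (Suc n) = F n * g (Suc n)" for n
    by (cases "even n") (auto simp: F_def g_def algebra_simps elim!: evenE oddE)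
  have Fnz: "F n \<noteq> 0" if "n \<le> d" for n
    using that
  proof (induction n)
    case (Suc n)
    with nz[of "Suc n div 2"] show ?case unfolding F_Suc by (auto simp: g_def elim!: evenE)
  qed (simp add: F_def)
  have one: "(-1 :: 'k alg_closure) \<noteq> 1"
    using two by (metis one_add_one add.left_inverse)
  have br: "bracket (-1) r' s' t' =
      (if odd r' \<and> odd s' \<and> odd t' then 0 else factorial_quotient F r' s' t')"
    if "r' + s' + t' \<le> d" for r' s' t'
    using char one Fnz[of r'] Fnz[of s'] Fnz[of t'] Fnz[of "r' + s' + t'"]
      Fnz[of "r' + s'"] Fnz[of "r' + t'"] Fnz[of "s' + t'"] that
    by (auto simp: bracket_def factorial_quotient_def F_def)
  obtain K where K:
    "factorial_quotient F (Suc r) (Suc s) t = K * (g (r + s + 2) * g (t + 1))"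
    "factorial_quotient F r (Suc s) (Suc t) = K * (g (s + t + 2) * g (r + 1))"
    "factorial_quotient F (Suc r) s (Suc t) = K * (g (r + t + 2) * g (s + 1))"
    using factorial_quotient_neighbours[of F g, OF F_Suc] Fnz d by metis
  define b1 b2 b3 where "b1 = bracket (-1 :: 'k alg_closure) (Suc r) (Suc s) t"
    and "b2 = bracket (-1 :: 'k alg_closure) r (Suc s) (Suc t)"
    and "b3 = bracket (-1 :: 'k alg_closure) (Suc r) s (Suc t)"
  have b: "b1 = (if even r \<and> even s \<and> odd t then 0 else K * (g (r + s + 2) * g (t + 1)))"
    "b2 = (if odd r \<and> even s \<and> even t then 0 else K * (g (s + t + 2) * g (r + 1)))"
    "b3 = (if even r \<and> odd s \<and> even t then 0 else K * (g (r + t + 2) * g (s + 1)))"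
    unfolding b1_def b2_def b3_def
    using br[of "Suc r" "Suc s" t] br[of r "Suc s" "Suc t"] br[of "Suc r" s "Suc t"] d K by simp_all
  have "(x (r + s + t + 2) - x s) * (b1 - b2) = (x (s + t + 1) - x (r + s + 1)) * b3"
  proof (cases "even (r + t)")
    case True
    have 1: "x (r + s + t + 2) - x s = (-1) ^ s * (\<gamma> * of_nat (r + t + 2))"
      using even_diff[of "r + s + t + 2" s] d True
      by (cases "even r"; cases "even s") (simp_all add: minus_one_power_iff)
    have 2: "x (s + t + 1) - x (r + s + 1) = (-1) ^ s * (-1) ^ (t + 1) * (\<gamma> * (of_nat t - of_nat r))"
      using even_diff[of "s + t + 1" "r + s + 1"] d True
      by (cases "even r"; cases "even s") (simp_all add: minus_one_power_iff)
    have "of_nat (r + t + 2) * (b1 - b2) = (-1) ^ (t + 1) * (of_nat t - of_nat r) * b3"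
      using True unfolding b
      by (cases "even r"; cases "even s")
        (auto simp: g_def minus_one_power_iff algebra_simps elim!: evenE oddE)
    then show ?thesis unfolding 1 2 by (simp add: mult.assoc)
  next
    case False
    define W where "W = 2 * \<beta> + \<gamma> * of_nat (r + 2 * s + t + 2)"
    have 1: "x (r + s + t + 2) - x s = (-1) ^ s * (-1) ^ (r + t) * W"
      using odd_diff[of "r + s + t + 2" s] d False
      by (cases "even r"; cases "even s") (simp_all add: minus_one_power_iff W_def algebra_simps)
    have 2: "x (s + t + 1) - x (r + s + 1) = (-1) ^ s * (-1) ^ (t + 1) * W"
      using odd_diff[of "s + t + 1" "r + s + 1"] d False
      by (cases "even r"; cases "even s") (simp_all add: minus_one_power_iff W_def algebra_simps)
    have sign: "(-1) ^ (r + t) * (b1 - b2) = (-1) ^ (t + 1) * b3"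
      using False unfolding b
      by (cases "even r"; cases "even s")
        (auto simp: g_def minus_one_power_iff algebra_simps elim!: evenE oddE)
    have "(-1) ^ s * (-1) ^ (r + t) * W * (b1 - b2) = (-1) ^ s * W * ((-1) ^ (r + t) * (b1 - b2))"
      by (simp only: mult_ac)
    then show ?thesis unfolding 1 2 sign by (simp only: mult_ac)
  qed
  then show ?thesis
    unfolding bracket_recurrence_def b1_def b2_def b3_def .
qed

text \<open>
  In characteristic 2 with \<open>q = 1\<close> the recurrence gives \<open>x\<^sub>4 = x\<^sub>0\<close>, so \<open>d \<le> 3\<close> and only four
  triples \<open>(r, s, t)\<close> remain.
\<close>
lemma bracket_recurrence_char_two:
  fixes x :: "nat \<Rightarrow> 'k::field alg_closure"
  assumes two: "(2::'k alg_closure) = 0" and char: "CHAR('k) = 2"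
    and x: "three_term d 3 x" and inj: "inj_on x {..d}" and d: "d = r + s + t + 2"
  shows "bracket_recurrence 1 r s t x"
proof -
  have three: "(3 :: 'k alg_closure) = 1"
    using two by (metis add_0 numeral_plus_one one_add_one semiring_norm(3,5))
  have comm: "y - z = z - y" for y z :: "'k alg_closure"
  proof -
    have "(y - z) - (z - y) = 2 * (y - z)" by (simp add: algebra_simps)
    then show ?thesis using two by simp
  qed
  have rec: "x i - x (i + 3) = x (i + 1) - x (i + 2)" if "i + 3 \<le> d" for i
    using x that unfolding three_term_def three by simp
  have "d < 4"
  proof (rule ccontr)
    assume "\<not> d < 4"
    then have "x 0 - x 3 = x 1 - x 2" "x 1 - x 4 = x 2 - x 3"
      using rec[of 0] rec[of 1] by (simp_all add: numeral_eq_Suc)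
    then have "x 4 = x 0"
      by (simp add: algebra_simps)
    with inj \<open>\<not> d < 4\<close> show False by (force dest: inj_onD)
  qed
  with d consider "r = 0" "s = 0" "t = 0" | "r = 1" "s = 0" "t = 0" | "r = 0" "s = 1" "t = 0"
    | "r = 0" "s = 0" "t = 1" by linarith
  then show ?thesis
  proof cases
    case 2
    have "x 3 - x 0 = x 1 - x 2"
      using rec[of 0] d 2 comm[of "x 3" "x 0"] by (simp add: numeral_2_eq_2)
    with 2 show ?thesis
      by (simp add: bracket_recurrence_def bracket_def char numeral_2_eq_2 numeral_3_eq_3)
  next
    case 4
    have "x 0 - x 3 = x 2 - x 1"
      using rec[of 0] d 4 two by (simp add: numeral_2_eq_2)
    with 4 show ?thesis
      by (simp add: bracket_recurrence_def bracket_def char numeral_2_eq_2 numeral_3_eq_3)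
  qed (simp_all add: bracket_recurrence_def bracket_def)
qed

lemma bracket_recurrence_holds:
  fixes q :: "'k::field alg_closure"
  assumes "q \<noteq> 0" and x: "three_term d (q + inverse q + 1) x" and inj: "inj_on x {..d}"
    and d: "d = r + s + t + 2"
  shows "bracket_recurrence q r s t x"
proof -
  have char: "(2::'k alg_closure) = 0 \<longleftrightarrow> CHAR('k) = 2"
  proof -
    have "(2::'k alg_closure) = 0 \<longleftrightarrow> of_nat 2 = (0 :: 'k)"
      by (metis to_ac_eq_0_iff to_ac_numeral of_nat_numeral)
    also have "\<dots> \<longleftrightarrow> CHAR('k) dvd 2" by (rule of_nat_eq_0_iff_char_dvd)
    also have "\<dots> \<longleftrightarrow> CHAR('k) = 2"
      by (metis CHAR_not_1' dvd_refl prime_nat_iff two_is_prime_nat One_nat_def)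
    finally show ?thesis .
  qed
  consider "q \<noteq> 1" "q \<noteq> -1" | "q = 1" "(2::'k alg_closure) \<noteq> 0" | "q = -1" "(2::'k alg_closure) \<noteq> 0"
    | "q = 1" "(2::'k alg_closure) = 0"
    by (metis add_eq_0_iff one_add_one)
  then show ?thesis
  proof cases
    case 1
    then show ?thesis using bracket_recurrence_generic assms by blast
  next
    case 2
    then show ?thesis using bracket_recurrence_one[OF _ _ _ inj d] x char by simp
  next
    case 3
    then show ?thesis using bracket_recurrence_minus_one[OF _ _ _ inj d] x char by simp
  next
    case 4
    then show ?thesis using bracket_recurrence_char_two[OF _ _ _ inj d] x char by simp
  qed
qed

text \<open>
  Both sides satisfy the same recursion in \<open>j\<close>. In the boundary cases \<open>i = 0\<close> and \<open>i = j\<close> the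
  brackets are \<open>1\<close>, and in the interior the recursion is \<open>bracket_recurrence\<close>.
\<close>
lemma connection_eq_bracket:
  assumes "q \<noteq> 0" and x: "three_term d (q + inverse q + 1) (\<lambda>i. to_ac (\<theta> i))"
    and inj: "inj_on \<theta> {..d}" and "i \<le> j" "j \<le> d"
  shows "to_ac (connection d \<theta> j i) =
    bracket q i (j - i) (d - j) * to_ac (poly (tau \<theta> (j - i)) (\<theta> d))"
  using \<open>i \<le> j\<close> \<open>j \<le> d\<close>
proof (induction j arbitrary: i)
  case 0
  then show ?case by (simp add: bracket_def)
next
  case (Suc j)
  have x': "inj_on (\<lambda>i. to_ac (\<theta> i)) {..d}"
    using inj by (auto simp: inj_on_def)
  consider "i = Suc j" | "i = 0" | r s t where "i = Suc r" "j = r + s + 1" "d = r + s + t + 2"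
  proof (cases "i = Suc j \<or> i = 0")
    case False
    then obtain r where r: "i = Suc r" using not0_implies_Suc by blast
    with False Suc.prems obtain s where s: "j = Suc r + s" by (metis le_SucE le_Suc_ex)
    from Suc.prems obtain t where "d = Suc j + t" by (metis le_Suc_ex)
    with r s show ?thesis by (intro that(3)[of r s t]) auto
  qed (use that in auto)
  then show ?case
  proof cases
    case 1
    with Suc show ?thesis by (simp add: bracket_def connection_eq_0)
  next
    case 2
    with Suc.IH[of 0] Suc.prems show ?thesis by (simp add: bracket_def tau_Suc algebra_simps)
  next
    case 3
    have "(to_ac (\<theta> d) - to_ac (\<theta> s)) * (bracket q (Suc r) (Suc s) t - bracket q r (Suc s) (Suc t)) =
      (to_ac (\<theta> (s + t + 1)) - to_ac (\<theta> (r + s + 1))) * bracket q (Suc r) s (Suc t)"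
      using bracket_recurrence_holds[OF assms(1) x x' 3(3)] unfolding bracket_recurrence_def 3(3) .
    then have "(to_ac (\<theta> d) - to_ac (\<theta> s)) * bracket q (Suc r) (Suc s) t =
      (to_ac (\<theta> d) - to_ac (\<theta> s)) * bracket q r (Suc s) (Suc t) +
      (to_ac (\<theta> (s + t + 1)) - to_ac (\<theta> (r + s + 1))) * bracket q (Suc r) s (Suc t)"
      by (simp add: algebra_simps)
    note rec = arg_cong[OF this, of "\<lambda>y. to_ac (poly (tau \<theta> s) (\<theta> d)) * y"]
    have IH: "to_ac (connection d \<theta> j r) =
        bracket q r (Suc s) (Suc t) * to_ac (poly (tau \<theta> s) (\<theta> d)) * (to_ac (\<theta> d) - to_ac (\<theta> s))"
      "to_ac (connection d \<theta> j (Suc r)) = bracket q (Suc r) s (Suc t) * to_ac (poly (tau \<theta> s) (\<theta> d))"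
      using Suc.IH[of r] Suc.IH[of "Suc r"] 3 by (simp_all add: tau_Suc Suc_diff_Suc algebra_simps)
    have "to_ac (connection d \<theta> (Suc j) i) =
       to_ac (connection d \<theta> j r) + (to_ac (\<theta> (s + t + 1)) - to_ac (\<theta> (r + s + 1))) * to_ac (connection d \<theta> j (Suc r))"
      using 3 by simp
    also have "\<dots> = to_ac (poly (tau \<theta> s) (\<theta> d)) * ((to_ac (\<theta> d) - to_ac (\<theta> s)) * bracket q (Suc r) (Suc s) t)"
      unfolding rec IH by (simp add: algebra_simps)
    also have "\<dots> = bracket q (Suc r) (Suc s) t * to_ac (poly (tau \<theta> (Suc s)) (\<theta> d))"
      by (simp add: tau_Suc algebra_simps)
    also have "bracket q (Suc r) (Suc s) t = bracket q i (Suc j - i) (d - Suc j)"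
      using 3 by simp
    finally show ?thesis using 3 by simp
  qed
qed

section \<open>Polynomials in an element of an algebra\<close>

context assoc_algebra
begin

lemma poly_in_eq_sum:
  assumes "degree p \<le> n"
  shows "poly_in scale p x = (\<Sum>k\<le>n. scale (coeff p k) (x ^ k))"
  unfolding poly_in_def
  using assms by (intro sum.mono_neutral_left) (auto simp: coeff_eq_0)

lemma poly_in_add: "poly_in scale (p + p') x = poly_in scale p x + poly_in scale p' x"
proof -
  define n where "n = max (degree p) (degree p')"
  have "degree (p + p') \<le> n" "degree p \<le> n" "degree p' \<le> n"
    by (simp_all add: n_def degree_add_le)
  then show ?thesis
    by (simp add: poly_in_eq_sum[of _ n] scale_left_distrib sum.distrib)
qed

lemma poly_in_smult: "poly_in scale (smult c p) x = scale c (poly_in scale p x)"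
  by (simp add: poly_in_eq_sum[of _ "degree p"] degree_smult_le scale_sum_right)

lemma poly_in_0: "poly_in scale 0 x = 0"
  by (simp add: poly_in_def)

lemma poly_in_1: "poly_in scale 1 x = 1"
  by (simp add: poly_in_def)

lemma poly_in_sum: "poly_in scale (\<Sum>i\<in>I. f i) x = (\<Sum>i\<in>I. poly_in scale (f i) x)"
  by (induction I rule: infinite_finite_induct) (simp_all add: poly_in_0 poly_in_add)

lemma poly_in_pCons_0: "poly_in scale (pCons 0 p) x = x * poly_in scale p x"
proof -
  have "poly_in scale (pCons 0 p) x = (\<Sum>k\<le>Suc (degree p). scale (coeff (pCons 0 p) k) (x ^ k))"
    by (rule poly_in_eq_sum) (rule degree_pCons_le)
  also have "\<dots> = (\<Sum>k\<le>degree p. scale (coeff p k) (x * x ^ k))"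
    by (subst sum.atMost_Suc_shift) simp
  also have "\<dots> = x * poly_in scale p x"
    by (simp add: poly_in_def sum_distrib_left scale_mult_right)
  finally show ?thesis .
qed

lemma poly_in_tau_Suc:
  "poly_in scale (tau \<theta> (Suc i)) x = x * poly_in scale (tau \<theta> i) x - scale (\<theta> i) (poly_in scale (tau \<theta> i) x)"
proof -
  have "tau \<theta> (Suc i) = pCons 0 (tau \<theta> i) + smult (- \<theta> i) (tau \<theta> i)"
    by (simp add: tau_Suc)
  then show ?thesis by (simp only: poly_in_add poly_in_pCons_0 poly_in_smult) simp
qed

end

section \<open>Matrix algebras and primitive idempotents\<close>

lemma mat_trace_commute:
  fixes M N :: "'k::comm_ring_1 mat"
  assumes M: "M \<in> carrier_mat n m" and N: "N \<in> carrier_mat m n"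
  shows "mat_trace (M * N) = mat_trace (N * M)"
proof -
  have "mat_trace (M * N) = (\<Sum>i<n. \<Sum>j<m. M $$ (i, j) * N $$ (j, i))"
    using M N by (simp add: mat_trace_def scalar_prod_def lessThan_atLeast0)
  also have "\<dots> = (\<Sum>j<m. \<Sum>i<n. N $$ (j, i) * M $$ (i, j))"
    by (subst sum.swap) (simp add: mult.commute)
  also have "\<dots> = mat_trace (N * M)"
    using M N by (simp add: mat_trace_def scalar_prod_def lessThan_atLeast0)
  finally show ?thesis .
qed

lemma mult_mat_zero_vec: "M \<in> carrier_mat n m \<Longrightarrow> M *\<^sub>v 0\<^sub>v m = 0\<^sub>v n"
  by (intro eq_vecI) (auto simp: scalar_prod_def)

definition matrix_unit :: "nat \<Rightarrow> nat \<Rightarrow> nat \<Rightarrow> 'k::field mat" where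
  "matrix_unit n r c = mat n n (\<lambda>(i, j). if i = r \<and> j = c then 1 else 0)"

abbreviation diagonal_unit :: "nat \<Rightarrow> nat \<Rightarrow> 'k::field mat" where
  "diagonal_unit n i \<equiv> matrix_unit n i i"

lemma diagonal_unit_carrier [simp]: "diagonal_unit n i \<in> carrier_mat n n"
  by (simp add: matrix_unit_def)

lemma diagonal_unit_mult_vec:
  assumes "i < n" "v \<in> carrier_vec n"
  shows "diagonal_unit n i *\<^sub>v v = v $ i \<cdot>\<^sub>v unit_vec n i"
proof
  fix r assume "r < dim_vec (v $ i \<cdot>\<^sub>v unit_vec n i)"
  then have r: "r < n" by simp
  have "(diagonal_unit n i *\<^sub>v v) $ r = (\<Sum>c<n. (if r = i \<and> c = i then 1 else 0) * v $ c)"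
    using r assms by (simp add: matrix_unit_def scalar_prod_def lessThan_atLeast0)
  also have "\<dots> = (\<Sum>c<n. if c = i then (if r = i then v $ c else 0) else 0)"
    by (rule sum.cong) auto
  also have "\<dots> = (v $ i \<cdot>\<^sub>v unit_vec n i) $ r"
    using assms r by simp
  finally show "(diagonal_unit n i *\<^sub>v v) $ r = (v $ i \<cdot>\<^sub>v unit_vec n i) $ r" .
qed (simp add: matrix_unit_def)

lemma mat_trace_mult_diagonal_unit:
  fixes M :: "'k::field mat"
  assumes "i < n" and M: "M \<in> carrier_mat n n"
  shows "mat_trace (M * diagonal_unit n i) = M $$ (i, i)"
proof -
  have "mat_trace (M * diagonal_unit n i)
      = (\<Sum>r<n. \<Sum>c<n. M $$ (r, c) * (if c = i \<and> r = i then 1 else 0))"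
    using M by (simp add: mat_trace_def scalar_prod_def matrix_unit_def lessThan_atLeast0)
  also have "\<dots> = (\<Sum>r<n. \<Sum>c<n. if c = i then (if r = i then M $$ (r, c) else 0) else 0)"
    by (intro sum.cong) auto
  also have "\<dots> = M $$ (i, i)"
    using assms(1) by simp
  finally show ?thesis .
qed

context matrix_algebra_iso
begin

lemma psi_carrier: "\<psi> x \<in> carrier_mat (d + 1) (d + 1)"
  using bij by (auto simp: bij_betw_def)

lemma dim_psi [simp]: "dim_row (\<psi> x) = d + 1" "dim_col (\<psi> x) = d + 1"
  using psi_carrier[of x] by auto

lemma psi_inject: "\<psi> x = \<psi> y \<longleftrightarrow> x = y"
  using bij by (auto simp: bij_betw_def inj_on_def)

lemma psi_mult_vec:
  assumes "v \<in> carrier_vec (d + 1)"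
  shows "\<psi> (x * y) *\<^sub>v v = \<psi> x *\<^sub>v (\<psi> y *\<^sub>v v)"
    and "\<psi> (x + y) *\<^sub>v v = \<psi> x *\<^sub>v v + \<psi> y *\<^sub>v v"
    and "\<psi> (scale c x) *\<^sub>v v = c \<cdot>\<^sub>v (\<psi> x *\<^sub>v v)"
    and "\<psi> 1 *\<^sub>v v = v"
    and "\<psi> 0 *\<^sub>v v = 0\<^sub>v (d + 1)"
proof -
  show "\<psi> (x * y) *\<^sub>v v = \<psi> x *\<^sub>v (\<psi> y *\<^sub>v v)"
    unfolding hom_mult by (rule assoc_mult_mat_vec[OF psi_carrier psi_carrier assms])
  show "\<psi> (x + y) *\<^sub>v v = \<psi> x *\<^sub>v v + \<psi> y *\<^sub>v v"
    unfolding hom_add by (rule add_mult_distrib_mat_vec[OF psi_carrier psi_carrier assms])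
  show s: "\<psi> (scale c x) *\<^sub>v v = c \<cdot>\<^sub>v (\<psi> x *\<^sub>v v)" for c x
    unfolding hom_scale using assms psi_carrier[of x] by (intro eq_vecI) (auto simp: scalar_prod_smult_left)
  show "\<psi> 1 *\<^sub>v v = v" unfolding hom_one using assms by simp
  show "\<psi> 0 *\<^sub>v v = 0\<^sub>v (d + 1)"
  proof -
    have "0 \<cdot>\<^sub>v (\<psi> 0 *\<^sub>v v) = 0\<^sub>v (d + 1)"
      using psi_carrier[of 0] by (intro eq_vecI) auto
    then show ?thesis using s[of 0 0] by simp
  qed
qed

end

text \<open>
  The next two lemmas amount to the simplicity of the matrix algebra, from which it follows that a
  nonzero module over it is faithful.
\<close>
lemma matrix_unit_sandwich:
  fixes M :: "'k::field mat"
  assumes M: "M \<in> carrier_mat n n" and "r < n" "c < n"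
  shows "matrix_unit n k r * M * matrix_unit n c k = M $$ (r, c) \<cdot>\<^sub>m matrix_unit n k k"
proof -
  have 1: "matrix_unit n k r * M = mat n n (\<lambda>(i, j). if i = k then M $$ (r, j) else 0)"
  proof (rule eq_matI)
    fix i j assume "i < dim_row (mat n n (\<lambda>(i, j). if i = k then M $$ (r, j) else 0))"
      and "j < dim_col (mat n n (\<lambda>(i, j). if i = k then M $$ (r, j) else 0))"
    then have ij: "i < n" "j < n" by simp_all
    have "(matrix_unit n k r * M) $$ (i, j) = (\<Sum>a<n. (if i = k \<and> a = r then 1 else 0) * M $$ (a, j))"
      using ij M by (simp add: matrix_unit_def scalar_prod_def lessThan_atLeast0)
    also have "\<dots> = (\<Sum>a<n. if a = r then (if i = k then M $$ (a, j) else 0) else 0)"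
      by (rule sum.cong) auto
    finally show "(matrix_unit n k r * M) $$ (i, j) = mat n n (\<lambda>(i, j). if i = k then M $$ (r, j) else 0) $$ (i, j)"
      using ij assms by simp
  qed (use M in \<open>simp_all add: matrix_unit_def\<close>)
  show ?thesis
    unfolding 1
  proof (rule eq_matI)
    let ?N = "mat n n (\<lambda>(i, j). if i = k then M $$ (r, j) else 0)"
    fix i j assume "i < dim_row (M $$ (r, c) \<cdot>\<^sub>m matrix_unit n k k)"
      and "j < dim_col (M $$ (r, c) \<cdot>\<^sub>m matrix_unit n k k)"
    then have ij: "i < n" "j < n" by (simp_all add: matrix_unit_def)
    have "(?N * matrix_unit n c k) $$ (i, j)
        = (\<Sum>a<n. (if i = k then M $$ (r, a) else 0) * (if a = c \<and> j = k then 1 else 0))"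
      using ij by (simp add: matrix_unit_def scalar_prod_def lessThan_atLeast0)
    also have "\<dots> = (\<Sum>a<n. if a = c then (if i = k \<and> j = k then M $$ (r, a) else 0) else 0)"
      by (rule sum.cong) auto
    finally show "(?N * matrix_unit n c k) $$ (i, j) = (M $$ (r, c) \<cdot>\<^sub>m matrix_unit n k k) $$ (i, j)"
      using ij assms by (simp add: matrix_unit_def)
  qed (simp_all add: matrix_unit_def)
qed

lemma (in matrix_algebra_iso) two_sided_ideal_contains_one:
  fixes J :: "'a set"
  assumes zero: "0 \<in> J" and add: "\<And>x y. x \<in> J \<Longrightarrow> y \<in> J \<Longrightarrow> x + y \<in> J"
    and mult: "\<And>x y z. x \<in> J \<Longrightarrow> y * x * z \<in> J" and x: "x \<in> J" "x \<noteq> 0"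
  shows "1 \<in> J"
proof -
  let ?n = "d + 1"
  have psi_0: "\<psi> 0 = 0\<^sub>m ?n ?n"
  proof -
    have "\<psi> (scale 0 0) = 0 \<cdot>\<^sub>m \<psi> 0" by (rule hom_scale)
    also have "0 \<cdot>\<^sub>m \<psi> 0 = 0\<^sub>m ?n ?n"
      by (intro eq_matI) auto
    finally show ?thesis by simp
  qed
  have "\<psi> x \<noteq> 0\<^sub>m ?n ?n"
    using x(2) psi_inject[of x 0] psi_0 by simp
  then obtain r c where rc: "r < ?n" "c < ?n" "\<psi> x $$ (r, c) \<noteq> 0"
    by (metis dim_psi eq_matI index_zero_mat)
  have surj: "\<exists>y. \<psi> y = M" if "M \<in> carrier_mat ?n ?n" for M
    using bij that by (metis bij_betw_imp_surj_on imageE)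
  define f where "f k = (SOME y. \<psi> y = matrix_unit ?n k k)" for k
  have f: "\<psi> (f k) = matrix_unit ?n k k" for k
    unfolding f_def by (rule someI_ex) (intro surj, simp add: matrix_unit_def)
  have f_J: "f k \<in> J" for k
  proof -
    obtain y z where y: "\<psi> y = matrix_unit ?n k r" and z: "\<psi> z = matrix_unit ?n c k"
      using surj[of "matrix_unit ?n k r"] surj[of "matrix_unit ?n c k"] by (auto simp: matrix_unit_def)
    have "\<psi> (y * x * scale (1 / \<psi> x $$ (r, c)) z) = \<psi> (scale (1 / \<psi> x $$ (r, c)) (y * x * z))"
      by (simp add: scale_mult_right)
    also have "\<dots> = (1 / \<psi> x $$ (r, c)) \<cdot>\<^sub>m (\<psi> x $$ (r, c) \<cdot>\<^sub>m matrix_unit ?n k k)"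
      unfolding hom_scale hom_mult y z matrix_unit_sandwich[OF psi_carrier rc(1,2)] ..
    also have "\<dots> = \<psi> (f k)"
      unfolding f using rc(3) by (intro eq_matI) (auto simp: matrix_unit_def)
    finally have "y * x * scale (1 / \<psi> x $$ (r, c)) z = f k"
      by (simp only: psi_inject)
    with mult[OF x(1)] show ?thesis by metis
  qed
  have "(\<Sum>k\<in>I. f k) \<in> J \<and> \<psi> (\<Sum>k\<in>I. f k) = mat ?n ?n (\<lambda>(i, j). if i = j \<and> i \<in> I then 1 else 0)"
    if "finite I" for I
    using that
  proof (induction I)
    case empty
    then show ?case using zero by (auto simp: psi_0 intro!: eq_matI)
  next
    case (insert k I)
    then have "\<psi> (\<Sum>k\<in>insert k I. f k) = matrix_unit ?n k k + mat ?n ?n (\<lambda>(i, j). if i = j \<and> i \<in> I then 1 else 0)"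
      by (simp add: hom_add f)
    also have "\<dots> = mat ?n ?n (\<lambda>(i, j). if i = j \<and> i \<in> insert k I then 1 else 0)"
      using insert.hyps by (intro eq_matI) (auto simp: matrix_unit_def)
    finally show ?case using insert add f_J by simp
  qed
  from this[of "{..<?n}"] have s: "(\<Sum>k<?n. f k) \<in> J"
    "\<psi> (\<Sum>k<?n. f k) = mat ?n ?n (\<lambda>(i, j). if i = j \<and> i \<in> {..<?n} then 1 else 0)"
    by blast+
  have "\<dots> = \<psi> 1"
    unfolding hom_one by (intro eq_matI) auto
  with s show ?thesis using psi_inject by metis
qed

text \<open>
  All facts about the idempotents follow from their action on one eigenvector of \<open>A\<close> for each
  eigenvalue: the idempotents are Lagrange interpolation polynomials in \<open>A\<close>, so they act on these
  eigenvectors as coordinate projections, and the eigenvectors form a basis.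
\<close>
locale primitive_idempotents = matrix_algebra_iso scale d \<psi>
  for scale :: "'k::field \<Rightarrow> 'a::ring_1 \<Rightarrow> 'a" and d :: nat and \<psi> :: "'a \<Rightarrow> 'k mat" +
  fixes A :: 'a and E :: "nat \<Rightarrow> 'a" and \<theta> :: "nat \<Rightarrow> 'k"
  assumes ordering: "idempotent_ordering scale d \<psi> A E \<theta>"
begin

lemma inj_eigenvalues: "inj_on \<theta> {..d}"
  using ordering by (auto simp: idempotent_ordering_def bij_betw_def)

definition eigvec :: "nat \<Rightarrow> 'k vec" where
  "eigvec j = (SOME v. eigenvector (\<psi> A) v (\<theta> j))"

lemma eigvec:
  assumes "j \<le> d"
  shows "eigvec j \<in> carrier_vec (d + 1)" "eigvec j \<noteq> 0\<^sub>v (d + 1)"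
    "\<psi> A *\<^sub>v eigvec j = \<theta> j \<cdot>\<^sub>v eigvec j"
proof -
  have "eigenvalue (\<psi> A) (\<theta> j)"
    using ordering assms by (auto simp: idempotent_ordering_def bij_betw_def)
  then have "eigenvector (\<psi> A) (eigvec j) (\<theta> j)"
    unfolding eigvec_def eigenvalue_def by (rule someI_ex)
  then show "eigvec j \<in> carrier_vec (d + 1)" "eigvec j \<noteq> 0\<^sub>v (d + 1)"
    "\<psi> A *\<^sub>v eigvec j = \<theta> j \<cdot>\<^sub>v eigvec j"
    using psi_carrier[of A] by (auto simp: eigenvector_def)
qed

lemma idempotent_eigvec:
  assumes i: "i \<le> d" and j: "j \<le> d"
  shows "\<psi> (E i) *\<^sub>v eigvec j = (if i = j then eigvec j else 0\<^sub>v (d + 1))"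
proof -
  let ?f = "\<lambda>h. scale (1 / (\<theta> i - \<theta> h)) (A - scale (\<theta> h) 1)"
  have f: "\<psi> (?f h) *\<^sub>v eigvec j = ((\<theta> j - \<theta> h) / (\<theta> i - \<theta> h)) \<cdot>\<^sub>v eigvec j" for h
  proof -
    have "A - scale (\<theta> h) 1 = A + scale (- \<theta> h) 1" by simp
    then have "\<psi> (A - scale (\<theta> h) 1) *\<^sub>v eigvec j = \<theta> j \<cdot>\<^sub>v eigvec j + (- \<theta> h) \<cdot>\<^sub>v eigvec j"
      by (simp only: psi_mult_vec[OF eigvec(1)[OF j]] eigvec(3)[OF j])
    also have "\<dots> = (\<theta> j - \<theta> h) \<cdot>\<^sub>v eigvec j"
      using eigvec(1)[OF j] by (intro eq_vecI) (auto simp: algebra_simps)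
    finally show ?thesis
      by (simp only: psi_mult_vec[OF eigvec(1)[OF j]] smult_smult_assoc) simp
  qed
  have "\<psi> (prod_list (map ?f hs)) *\<^sub>v eigvec j =
      prod_list (map (\<lambda>h. (\<theta> j - \<theta> h) / (\<theta> i - \<theta> h)) hs) \<cdot>\<^sub>v eigvec j" for hs
    using eigvec(1)[OF j] f
    by (induction hs)
      (simp_all add: psi_mult_vec mult_mat_vec[OF psi_carrier] smult_smult_assoc mult.commute)
  note products = this
  define js where "js = filter (\<lambda>j. j \<noteq> i) [0..<d + 1]"
  have "E i = prod_list (map ?f js)"
    using ordering i by (simp only: idempotent_ordering_def primitive_idempotent_def js_def)
  then have *: "\<psi> (E i) *\<^sub>v eigvec j =
      prod_list (map (\<lambda>h. (\<theta> j - \<theta> h) / (\<theta> i - \<theta> h)) js) \<cdot>\<^sub>v eigvec j"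
    using products by simp
  have js: "set js = {..d} - {i}" by (auto simp: js_def)
  show ?thesis
  proof (cases "i = j")
    case True
    have "prod_list xs = 1" if "\<forall>x\<in>set xs. x = 1" for xs :: "'k list"
      using that by (induction xs) auto
    moreover have "\<forall>x\<in>set (map (\<lambda>h. (\<theta> j - \<theta> h) / (\<theta> i - \<theta> h)) js). x = 1"
      using inj_onD[OF inj_eigenvalues, of i] i True js by auto
    ultimately have "prod_list (map (\<lambda>h. (\<theta> j - \<theta> h) / (\<theta> i - \<theta> h)) js) = 1"
      by blast
    then show ?thesis using * True by simp
  next
    case False
    then have "prod_list (map (\<lambda>h. (\<theta> j - \<theta> h) / (\<theta> i - \<theta> h)) js) = 0"
      using j js by (force simp: prod_list_zero_iff)
    moreover have "0 \<cdot>\<^sub>v eigvec j = 0\<^sub>v (d + 1)"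
      using eigvec(1)[OF j] by (intro eq_vecI) auto
    ultimately show ?thesis unfolding * using False by (simp only: if_False)
  qed
qed

definition eigmat :: "'k mat" where
  "eigmat = mat (d + 1) (d + 1) (\<lambda>(r, c). eigvec c $ r)"

lemma eigmat_carrier: "eigmat \<in> carrier_mat (d + 1) (d + 1)"
  by (simp add: eigmat_def)

lemma col_eigmat: "j \<le> d \<Longrightarrow> col eigmat j = eigvec j"
  using eigvec(1)[of j] by (intro eq_vecI) (auto simp: eigmat_def)

lemma eigmat_mult_unit_vec:
  assumes "j \<le> d"
  shows "eigmat *\<^sub>v unit_vec (d + 1) j = eigvec j"
  using assms eigmat_carrier eigvec(1)[OF assms]
  by (intro eq_vecI) (auto simp: eigmat_def scalar_prod_def sum.remove[of _ j])

lemma idempotent_eigmat: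
  assumes i: "i \<le> d"
  shows "\<psi> (E i) * eigmat = eigmat * diagonal_unit (d + 1) i"
proof (rule mat_col_eqI)
  fix j assume "j < dim_col (eigmat * diagonal_unit (d + 1) i)"
  then have j: "j \<le> d" by (simp add: matrix_unit_def)
  have "col (\<psi> (E i) * eigmat) j = \<psi> (E i) *\<^sub>v eigvec j"
    using j by (subst col_mult2[OF psi_carrier eigmat_carrier]) (simp_all add: col_eigmat)
  moreover have "col (eigmat * diagonal_unit (d + 1) i) j
      = eigmat *\<^sub>v (if i = j then unit_vec (d + 1) i else 0\<^sub>v (d + 1))"
    using j by (subst col_mult2[OF eigmat_carrier diagonal_unit_carrier])
      (auto simp: matrix_unit_def intro!: arg_cong[of _ _ "\<lambda>v. eigmat *\<^sub>v v"] eq_vecI)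
  moreover have "eigmat *\<^sub>v 0\<^sub>v (d + 1) = 0\<^sub>v (d + 1)"
    by (rule mult_mat_zero_vec[OF eigmat_carrier])
  ultimately show "col (\<psi> (E i) * eigmat) j = col (eigmat * diagonal_unit (d + 1) i) j"
    using idempotent_eigvec[OF i j] eigmat_mult_unit_vec[OF i] by auto
qed (use eigmat_carrier in \<open>auto simp: matrix_unit_def\<close>)

text \<open>
  A vector annihilated by the eigenvector matrix has all coordinates zero, as one sees by applying
  the idempotents to the corresponding linear combination of eigenvectors.
\<close>
lemma eigmat_inverse:
  obtains Q where "Q \<in> carrier_mat (d + 1) (d + 1)" "eigmat * Q = 1\<^sub>m (d + 1)" "Q * eigmat = 1\<^sub>m (d + 1)"
proof -
  have "Determinant.det eigmat \<noteq> 0"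
  proof
    assume "Determinant.det eigmat = 0"
    then obtain v where v: "v \<in> carrier_vec (d + 1)" "v \<noteq> 0\<^sub>v (d + 1)" "eigmat *\<^sub>v v = 0\<^sub>v (d + 1)"
      using det_0_iff_vec_prod_zero_field[OF eigmat_carrier] by blast
    have "v $ i = 0" if i: "i \<le> d" for i
    proof -
      have "0\<^sub>v (d + 1) = \<psi> (E i) *\<^sub>v (eigmat *\<^sub>v v)"
        unfolding v by (rule mult_mat_zero_vec[OF psi_carrier, symmetric])
      also have "\<dots> = eigmat *\<^sub>v (diagonal_unit (d + 1) i *\<^sub>v v)"
        by (simp only: idempotent_eigmat[OF i] flip: assoc_mult_mat_vec[OF psi_carrier eigmat_carrier v(1)]
            assoc_mult_mat_vec[OF eigmat_carrier diagonal_unit_carrier v(1)])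
      also have "\<dots> = v $ i \<cdot>\<^sub>v eigvec i"
        using i v(1) eigmat_mult_unit_vec[OF i]
        by (simp add: diagonal_unit_mult_vec mult_mat_vec[OF eigmat_carrier])
      finally have z: "v $ i \<cdot>\<^sub>v eigvec i = 0\<^sub>v (d + 1)" ..
      obtain r where "r < d + 1" "eigvec i $ r \<noteq> 0"
        using eigvec(1,2)[OF i] by (metis carrier_vecD eq_vecI index_zero_vec)
      then show ?thesis
        using arg_cong[OF z, of "\<lambda>w. vec_index w r"] eigvec(1)[OF i] by auto
    qed
    then have "v = 0\<^sub>v (d + 1)"
      using v(1) by (intro eq_vecI) auto
    with v(2) show False by contradiction
  qed
  then show thesis
    using det_non_zero_imp_unit[OF eigmat_carrier, of "()"] that
    by (auto simp: Units_def ring_mat_def)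
qed

lemma eq_if_agree_on_eigvecs:
  assumes "\<And>j. j \<le> d \<Longrightarrow> \<psi> x *\<^sub>v eigvec j = \<psi> y *\<^sub>v eigvec j"
  shows "x = y"
proof -
  obtain Q where Q: "Q \<in> carrier_mat (d + 1) (d + 1)" "eigmat * Q = 1\<^sub>m (d + 1)"
    using eigmat_inverse by blast
  have "\<psi> x * eigmat = \<psi> y * eigmat"
    using assms eigmat_carrier
    by (intro mat_col_eqI) (auto simp: col_mult2[OF psi_carrier eigmat_carrier] col_eigmat)
  then have "\<psi> x * eigmat * Q = \<psi> y * eigmat * Q" by simp
  then have "\<psi> x = \<psi> y"
    unfolding assoc_mult_mat[OF psi_carrier eigmat_carrier Q(1)] Q(2)
    by (simp only: right_mult_one_mat[OF psi_carrier])
  then show ?thesis by (simp add: psi_inject)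
qed

lemma psi_mult_zero_vec [simp]: "\<psi> x *\<^sub>v 0\<^sub>v (Suc d) = 0\<^sub>v (Suc d)"
  using mult_mat_zero_vec[OF psi_carrier[of x]] by simp

lemma idempotent_mult:
  assumes "i \<le> d" "j \<le> d"
  shows "E i * E j = (if i = j then E i else 0)"
  using assms eigvec(1)
  by (intro eq_if_agree_on_eigvecs) (auto simp: psi_mult_vec idempotent_eigvec)

lemma sum_idempotents: "(\<Sum>i\<le>d. E i) = 1"
proof (rule eq_if_agree_on_eigvecs)
  fix j assume j: "j \<le> d"
  have "\<psi> (\<Sum>i\<in>I. E i) *\<^sub>v eigvec j = (if j \<in> I then eigvec j else 0\<^sub>v (d + 1))" if "finite I" "I \<subseteq> {..d}" for I
    using that eigvec(1)[OF j]
    by (induction I) (auto simp: psi_mult_vec idempotent_eigvec[OF _ j])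
  from this[of "{..d}"] j eigvec(1)[OF j]
  show "\<psi> (\<Sum>i\<le>d. E i) *\<^sub>v eigvec j = \<psi> 1 *\<^sub>v eigvec j"
    by (simp add: psi_mult_vec)
qed

lemma mult_idempotent:
  assumes i: "i \<le> d"
  shows "A * E i = scale (\<theta> i) (E i)" "E i * A = scale (\<theta> i) (E i)"
proof -
  have 0: "c \<cdot>\<^sub>v 0\<^sub>v (Suc d) = (0\<^sub>v (Suc d) :: 'k vec)" for c by auto
  show "A * E i = scale (\<theta> i) (E i)" "E i * A = scale (\<theta> i) (E i)"
    using i eigvec
    by (auto intro!: eq_if_agree_on_eigvecs
        simp: psi_mult_vec idempotent_eigvec mult_mat_vec[OF psi_carrier] 0)
qed

lemma idempotent_nonzero:
  assumes i: "i \<le> d"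
  shows "E i \<noteq> 0"
proof
  assume "E i = 0"
  then have "eigvec i = 0\<^sub>v (d + 1)"
    using idempotent_eigvec[OF i i] psi_mult_vec(5)[OF eigvec(1)[OF i]] by simp
  with eigvec(2)[OF i] show False by contradiction
qed

text \<open>
  In the basis of eigenvectors \<open>E i\<close> is a diagonal matrix unit, so both sides are governed by
  the same diagonal entry of \<open>Z\<close>. This translates the traces in the split sequences into scalars.
\<close>
lemma idempotent_sandwich:
  assumes i: "i \<le> d"
  shows "E i * Z * E i = scale (mat_trace (\<psi> (Z * E i))) (E i)"
proof -
  obtain Q where Q: "Q \<in> carrier_mat (d + 1) (d + 1)" "eigmat * Q = 1\<^sub>m (d + 1)" "Q * eigmat = 1\<^sub>m (d + 1)"
    using eigmat_inverse by blast
  let ?D = "diagonal_unit (d + 1) i"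
  note prod = mult_carrier_mat[OF psi_carrier eigmat_carrier]
  have E: "\<psi> (E i) = eigmat * ?D * Q"
  proof -
    have "\<psi> (E i) = \<psi> (E i) * (eigmat * Q)"
      unfolding Q(2) by (simp only: right_mult_one_mat[OF psi_carrier])
    also have "\<dots> = eigmat * ?D * Q"
      by (simp only: idempotent_eigmat[OF i] flip: assoc_mult_mat[OF psi_carrier eigmat_carrier Q(1)])
    finally show ?thesis .
  qed
  define N where "N = Q * (\<psi> Z * eigmat)"
  have N: "N \<in> carrier_mat (d + 1) (d + 1)"
    unfolding N_def by (rule mult_carrier_mat[OF Q(1) prod])
  have "mat_trace (\<psi> (Z * E i)) = mat_trace ((\<psi> Z * eigmat * ?D) * Q)"
    unfolding hom_mult E
    by (simp only: assoc_mult_mat[OF mult_carrier_mat[OF psi_carrier eigmat_carrier] diagonal_unit_carrier Q(1)]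
        assoc_mult_mat[OF psi_carrier eigmat_carrier mult_carrier_mat[OF diagonal_unit_carrier Q(1)]]
        assoc_mult_mat[OF eigmat_carrier diagonal_unit_carrier Q(1)])
  also have "\<dots> = mat_trace (Q * (\<psi> Z * eigmat * ?D))"
    by (rule mat_trace_commute[OF mult_carrier_mat[OF prod diagonal_unit_carrier] Q(1)])
  also have "Q * (\<psi> Z * eigmat * ?D) = N * ?D"
    unfolding N_def by (rule assoc_mult_mat[symmetric, OF Q(1) prod diagonal_unit_carrier])
  also have "mat_trace (N * ?D) = N $$ (i, i)"
    using i N by (intro mat_trace_mult_diagonal_unit) auto
  finally have tr: "mat_trace (\<psi> (Z * E i)) = N $$ (i, i)" .
  have "\<psi> (E i * Z) *\<^sub>v eigvec i = N $$ (i, i) \<cdot>\<^sub>v eigvec i"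
  proof -
    let ?u = "unit_vec (d + 1) i :: 'k vec"
    have u: "?u \<in> carrier_vec (d + 1)" by simp
    have "\<psi> (E i * Z) *\<^sub>v eigvec i = (eigmat * ?D * Q) *\<^sub>v (\<psi> Z *\<^sub>v (eigmat *\<^sub>v ?u))"
      using i by (simp only: psi_mult_vec[OF eigvec(1)] E eigmat_mult_unit_vec)
    also have "\<dots> = (eigmat * ?D) *\<^sub>v (Q *\<^sub>v ((\<psi> Z * eigmat) *\<^sub>v ?u))"
      by (simp only: assoc_mult_mat_vec[OF psi_carrier eigmat_carrier u]
          assoc_mult_mat_vec[OF mult_carrier_mat[OF eigmat_carrier diagonal_unit_carrier] Q(1)
            mult_mat_vec_carrier[OF psi_carrier mult_mat_vec_carrier[OF eigmat_carrier u]]])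
    also have "Q *\<^sub>v ((\<psi> Z * eigmat) *\<^sub>v ?u) = N *\<^sub>v ?u"
      unfolding N_def by (rule assoc_mult_mat_vec[symmetric, OF Q(1) mult_carrier_mat[OF psi_carrier eigmat_carrier] u])
    also have "(eigmat * ?D) *\<^sub>v (N *\<^sub>v ?u) = eigmat *\<^sub>v (?D *\<^sub>v (N *\<^sub>v ?u))"
      by (rule assoc_mult_mat_vec[OF eigmat_carrier diagonal_unit_carrier mult_mat_vec_carrier[OF N u]])
    also have "?D *\<^sub>v (N *\<^sub>v ?u) = N $$ (i, i) \<cdot>\<^sub>v ?u"
      using i N by (subst diagonal_unit_mult_vec[OF _ mult_mat_vec_carrier[OF N u]]) auto
    also have "eigmat *\<^sub>v (N $$ (i, i) \<cdot>\<^sub>v ?u) = N $$ (i, i) \<cdot>\<^sub>v eigvec i"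
      by (simp only: mult_mat_vec[OF eigmat_carrier u] eigmat_mult_unit_vec[OF i])
    finally show ?thesis .
  qed
  moreover have "0\<^sub>v (Suc d) = c \<cdot>\<^sub>v (0\<^sub>v (Suc d) :: 'k vec)" for c by auto
  ultimately show ?thesis
    unfolding tr using i
    by (intro eq_if_agree_on_eigvecs)
      (auto simp: psi_mult_vec[OF eigvec(1)] psi_mult_vec[OF mult_mat_vec_carrier[OF psi_carrier eigvec(1)]] idempotent_eigvec)
qed

end

lemma eigenvalues_determined:
  assumes "primitive_idempotents scale d \<psi> A E \<theta>" "primitive_idempotents scale d \<psi> A E \<theta>'" "i \<le> d"
  shows "\<theta> i = \<theta>' i"
proof -
  interpret I: primitive_idempotents scale d \<psi> A E \<theta> by (rule assms)
  interpret J: primitive_idempotents scale d \<psi> A E \<theta>' by (rule assms)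
  have "scale (\<theta> i) (E i) = scale (\<theta>' i) (E i)"
    by (rule trans[OF I.mult_idempotent(1)[OF assms(3), symmetric] J.mult_idempotent(1)[OF assms(3)]])
  then show ?thesis using I.idempotent_nonzero[OF assms(3)] by auto
qed

section \<open>Operators with a spectral decomposition\<close>

text \<open>
  The vectors \<open>\<tau>\<^sub>i(a) v\<close>, defined for an operator that need not come from an algebra.
\<close>
primrec newton_vector ::
  "('k \<Rightarrow> 'v \<Rightarrow> 'v) \<Rightarrow> ('v \<Rightarrow> 'v) \<Rightarrow> (nat \<Rightarrow> 'k) \<Rightarrow> 'v \<Rightarrow> nat \<Rightarrow> 'v::ab_group_add"
where
  "newton_vector scale a \<theta> v 0 = v"
| "newton_vector scale a \<theta> v (Suc i) =
     a (newton_vector scale a \<theta> v i) - scale (\<theta> i) (newton_vector scale a \<theta> v i)"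

text \<open>
  A diagonalizable operator \<open>a\<close> with one-dimensional eigenspaces, given together with the projections
  \<open>e i\<close> onto them. Stating this for operators makes it possible to use the same lemmas for \<open>A\<close>, for
  \<open>A\<^sup>*\<close> and for the reversed orderings of their eigenspaces.
\<close>
locale spectral_operator = vector_space scale
  for scale :: "'k::field \<Rightarrow> 'v::ab_group_add \<Rightarrow> 'v" +
  fixes d :: nat and a :: "'v \<Rightarrow> 'v" and e :: "nat \<Rightarrow> 'v \<Rightarrow> 'v" and \<theta> :: "nat \<Rightarrow> 'k"
  assumes a_hom: "module_hom scale scale a"
    and e_hom: "i \<le> d \<Longrightarrow> module_hom scale scale (e i)"
    and e_e: "i \<le> d \<Longrightarrow> j \<le> d \<Longrightarrow> e i (e j x) = (if i = j then e i x else 0)"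
    and sum_e: "(\<Sum>i\<le>d. e i x) = x"
    and e_a: "i \<le> d \<Longrightarrow> e i (a x) = scale (\<theta> i) (e i x)"
    and a_e: "i \<le> d \<Longrightarrow> a (e i x) = scale (\<theta> i) (e i x)"
    and inj: "inj_on \<theta> {..d}"
    and e_line: "i \<le> d \<Longrightarrow> e i x \<noteq> 0 \<Longrightarrow> \<exists>c. e i y = scale c (e i x)"
    and e_nonzero: "i \<le> d \<Longrightarrow> \<exists>x. e i x \<noteq> 0"
begin

lemmas a_simps = module_hom.add[OF a_hom] module_hom.scale[OF a_hom] module_hom.diff[OF a_hom]
  module_hom.zero[OF a_hom] module_hom.sum[OF a_hom]

lemmas e_simps = module_hom.add[OF e_hom] module_hom.scale[OF e_hom] module_hom.diff[OF e_hom]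
  module_hom.zero[OF e_hom] module_hom.sum[OF e_hom]

lemma eq_0_if_e_eq_0: "(\<And>i. i \<le> d \<Longrightarrow> e i x = 0) \<Longrightarrow> x = 0"
  using sum_e[of x] by simp

abbreviation raise :: "'v \<Rightarrow> nat \<Rightarrow> 'v" where
  "raise \<equiv> newton_vector scale a \<theta>"

lemma raise_Suc': "raise v (Suc i) = raise (a v - scale (\<theta> i) v) i"
proof -
  have "raise (a v - scale c v) i = a (raise v i) - scale c (raise v i)" for c
    by (induction i) (simp_all add: a_simps scale_right_diff_distrib scale_left_commute)
  then show ?thesis by simp
qed

lemma raise_hom: "module_hom scale scale (\<lambda>v. raise v i)"
proof (unfold_locales)
  show "raise (x + y) i = raise x i + raise y i" for x y
    by (induction i) (simp_all add: a_simps scale_right_distrib)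
  show "raise (scale c x) i = scale c (raise x i)" for c x
    by (induction i) (simp_all add: a_simps scale_right_diff_distrib scale_left_commute)
qed

lemma e_raise: "j \<le> d \<Longrightarrow> e j (raise v i) = scale (poly (tau \<theta> i) (\<theta> j)) (e j v)"
  by (induction i) (simp_all add: tau_Suc e_simps e_a algebra_simps flip: scale_left_diff_distrib)

lemma eigvec_eq_e:
  assumes "j \<le> d" "a x = scale (\<theta> j) x"
  shows "e j x = x"
proof -
  have "e i x = 0" if "i \<le> d" "i \<noteq> j" for i
  proof -
    have "scale (\<theta> i) (e i x) = scale (\<theta> j) (e i x)"
      using e_a[OF that(1), of x] assms e_simps(2)[OF that(1)] by auto
    moreover have "\<theta> i \<noteq> \<theta> j" using inj that assms(1) by (auto dest: inj_onD)
    ultimately show ?thesis by auto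
  qed
  then have "(\<Sum>i\<le>d. e i x) = e j x"
    using assms(1) by (subst sum.remove[of _ j]) auto
  then show ?thesis by (simp add: sum_e)
qed

text \<open>
  Two families of vectors on which \<open>a\<close> is lower bidiagonal with the same diagonal are matched by an
  operator that is diagonal on the eigenspaces of \<open>a\<close>. In the induction step the difference \<open>x\<close> of the
  two sides is fixed by \<open>e (Suc i)\<close>, being an eigenvector; and it is annihilated by \<open>e (Suc i)\<close>, because
  \<open>u\<close> and \<open>u'\<close> have the same leading component.
\<close>
lemma intertwiner_on_split_vectors:
  assumes S_hom: "module_hom scale scale S" and S_a: "\<And>x. S (a x) = a (S x)"
    and e_S: "\<And>i x. i \<le> d \<Longrightarrow> e i (S x) = scale ((\<Prod>k\<in>{1..i}. \<phi>' k) / (\<Prod>k\<in>{1..i}. \<phi> k)) (e i x)"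
    and u: "\<And>i. Suc i \<le> d \<Longrightarrow> a (u (Suc i)) = scale (\<theta> (Suc i)) (u (Suc i)) + scale (\<phi> (Suc i)) (u i)"
    and u': "\<And>i. Suc i \<le> d \<Longrightarrow> a (u' (Suc i)) = scale (\<theta> (Suc i)) (u' (Suc i)) + scale (\<phi>' (Suc i)) (u' i)"
    and nz: "\<And>i. Suc i \<le> d \<Longrightarrow> \<phi> (Suc i) \<noteq> 0"
    and top: "\<And>i. i \<le> d \<Longrightarrow> e i (u i) = e i (u' i)"
    and u0: "u 0 = u' 0" "e 0 (u 0) = u 0"
    and "i \<le> d"
  shows "S (u' i) = scale ((\<Prod>k\<in>{1..i}. \<phi>' k) / (\<Prod>k\<in>{1..i}. \<phi> k)) (u i)"
  using \<open>i \<le> d\<close>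
proof (induction i)
  case 0
  have "S (u 0) = u 0"
  proof -
    have same: "e i (S (u 0)) = e i (u 0)" if "i \<le> d" for i
      using e_S[OF that, of "u 0"] e_e[OF that, of 0 "u 0"] u0 by (cases "i = 0") auto
    have "S (u 0) - u 0 = 0" by (rule eq_0_if_e_eq_0) (simp add: e_simps same)
    then show ?thesis by simp
  qed
  then show ?case by (simp add: u0(1)[symmetric])
next
  case (Suc i)
  define l where "l i = (\<Prod>k\<in>{1..i}. \<phi>' k) / (\<Prod>k\<in>{1..i}. \<phi> k)" for i
  have l: "l (Suc i) * \<phi> (Suc i) = \<phi>' (Suc i) * l i"
    using nz[OF Suc.prems] by (simp add: l_def prod.nat_ivl_Suc')
  define x where "x = S (u' (Suc i)) - scale (l (Suc i)) (u (Suc i))"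
  have "a x = scale (\<theta> (Suc i)) x + scale (\<phi>' (Suc i)) (S (u' i)) - scale (l (Suc i) * \<phi> (Suc i)) (u i)"
    unfolding x_def
    by (simp add: a_simps S_a[symmetric] u[OF Suc.prems] u'[OF Suc.prems] module_hom.add[OF S_hom]
        module_hom.scale[OF S_hom] scale_right_distrib scale_right_diff_distrib algebra_simps)
  also have "\<dots> = scale (\<theta> (Suc i)) x"
    using Suc unfolding l by (simp add: l_def)
  finally have "e (Suc i) x = x"
    using eigvec_eq_e[of "Suc i" x] Suc.prems by simp
  moreover have "e (Suc i) x = 0"
    unfolding x_def using e_S[OF Suc.prems] top[OF Suc.prems] Suc.prems by (simp add: e_simps l_def)
  ultimately show ?case by (simp add: x_def l_def)
qed

end

lemma spectral_operator_reverse: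
  assumes "spectral_operator scale d a e \<theta>"
  shows "spectral_operator scale d a (\<lambda>i. e (d - i)) (\<lambda>i. \<theta> (d - i))"
proof -
  interpret spectral_operator scale d a e \<theta> by (rule assms)
  show ?thesis
  proof (intro spectral_operator.intro spectral_operator_axioms.intro)
    show "vector_space scale" ..
    show "module_hom scale scale a" by (rule a_hom)
    show "(\<Sum>i\<le>d. e (d - i) x) = x" for x
      using sum.nat_diff_reindex[of "\<lambda>i. e i x" "Suc d"] sum_e[of x]
      by (simp add: lessThan_Suc_atMost)
    show "inj_on (\<lambda>i. \<theta> (d - i)) {..d}"
      using inj by (force simp: inj_on_def)
  qed (auto simp: e_hom e_e e_a a_e e_line e_nonzero)
qed

section \<open>The split bases of a tridiagonal pair of operators\<close>

text \<open>
  Only the half of tridiagonality that the split basis uses: \<open>a\<close> raises the index of the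
  eigenspaces of \<open>b\<close> by at most one, and \<open>b\<close> lowers the index of those of \<open>a\<close> by at most one.
  A Leonard system satisfies this for both orders of the \<open>e i\<close>, the given one and its reverse,
  so one locale serves for both split bases.
\<close>
locale split_operators =
  A: spectral_operator scale d a e \<theta> + B: spectral_operator scale d b es \<theta>s
  for scale :: "'k::field \<Rightarrow> 'v::ab_group_add \<Rightarrow> 'v" and d :: nat
    and a :: "'v \<Rightarrow> 'v" and e :: "nat \<Rightarrow> 'v \<Rightarrow> 'v" and \<theta> :: "nat \<Rightarrow> 'k"
    and b :: "'v \<Rightarrow> 'v" and es :: "nat \<Rightarrow> 'v \<Rightarrow> 'v" and \<theta>s :: "nat \<Rightarrow> 'k" +
  fixes v0 :: 'v
  assumes es_a_es: "Suc j < k \<Longrightarrow> k \<le> d \<Longrightarrow> es k (a (es j x)) = 0"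
    and es_a_es_Suc: "j < d \<Longrightarrow> \<exists>x. es (Suc j) (a (es j x)) \<noteq> 0"
    and e_b_e: "Suc j < k \<Longrightarrow> k \<le> d \<Longrightarrow> e j (b (e k x)) = 0"
    and e_b_e_Suc: "j < d \<Longrightarrow> \<exists>x. e j (b (e (Suc j) x)) \<noteq> 0"
    and es_v0: "es 0 v0 = v0" and v0_nonzero: "v0 \<noteq> 0"
begin

abbreviation w where "w \<equiv> A.raise v0"

lemma es_a: "k \<le> d \<Longrightarrow> es k (a x) = (\<Sum>j\<le>d. es k (a (es j x)))"
  by (subst B.sum_e[of x, symmetric]) (simp only: A.a_simps B.e_simps)

lemma e_b: "k \<le> d \<Longrightarrow> e k (b x) = (\<Sum>j\<le>d. e k (b (e j x)))"
  by (subst A.sum_e[of x, symmetric]) (simp only: B.a_simps A.e_simps)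

lemma es_w_above: "i < k \<Longrightarrow> k \<le> d \<Longrightarrow> es k (w i) = 0"
proof (induction i arbitrary: k)
  case 0
  then show ?case using B.e_e[of k 0 v0] by (simp add: es_v0)
next
  case (Suc i)
  have "es k (a (es j (w i))) = 0" if "j \<le> d" for j
  proof (cases "j \<le> i")
    case True
    then show ?thesis using es_a_es[of j k] Suc.prems by simp
  next
    case False
    then show ?thesis using Suc.IH[of j] that Suc.prems by (simp add: A.a_simps B.e_simps)
  qed
  then have "es k (a (w i)) = 0" using es_a[of k "w i"] Suc.prems by simp
  then show ?case using Suc by (simp add: B.e_simps)
qed

lemma es_w_Suc:
  assumes "Suc i \<le> d"
  shows "es (Suc i) (w (Suc i)) = es (Suc i) (a (es i (w i)))"
proof -
  have "es (Suc i) (a (es j (w i))) = 0" if "j \<le> d" "j \<noteq> i" for j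
  proof (cases "j < i")
    case True
    then show ?thesis using es_a_es[of j "Suc i"] assms by simp
  next
    case False
    then show ?thesis using es_w_above[of i j] that assms by (simp add: A.a_simps B.e_simps)
  qed
  then have "(\<Sum>j\<le>d. es (Suc i) (a (es j (w i)))) = es (Suc i) (a (es i (w i)))"
    using assms by (subst sum.remove[of _ i]) auto
  then have "es (Suc i) (a (w i)) = es (Suc i) (a (es i (w i)))"
    using es_a[of "Suc i" "w i"] assms by simp
  then show ?thesis using assms es_w_above[of i "Suc i"] by (simp add: B.e_simps)
qed

lemma es_w_nonzero: "i \<le> d \<Longrightarrow> es i (w i) \<noteq> 0"
proof (induction i)
  case 0
  then show ?case by (simp add: es_v0 v0_nonzero)
next
  case (Suc i)
  obtain x where x: "es (Suc i) (a (es i x)) \<noteq> 0"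
    using es_a_es_Suc[of i] Suc.prems by auto
  obtain c where "es i x = scale c (es i (w i))"
    using B.e_line[of i "w i" x] Suc by auto
  with x have "es (Suc i) (a (es i (w i))) \<noteq> 0"
    using Suc.prems by (auto simp: A.a_simps B.e_simps)
  then show ?case using es_w_Suc[of i] Suc.prems by simp
qed

text \<open>
  The vectors \<open>w 0, \<dots>, w (n - 1)\<close> span the flag \<open>es 0 V + \<dots> + es (n - 1) V\<close>, because the leading
  component of \<open>w n\<close> is nonzero and \<open>es n V\<close> is a line.
\<close>
lemma span_w:
  assumes "n \<le> Suc d" "\<And>k. n \<le> k \<Longrightarrow> k \<le> d \<Longrightarrow> es k x = 0"
  shows "\<exists>c. x = (\<Sum>k<n. scale (c k) (w k))"
  using assms
proof (induction n arbitrary: x)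
  case 0
  then show ?case using B.eq_0_if_e_eq_0[of x] by simp
next
  case (Suc n)
  obtain c where c: "es n x = scale c (es n (w n))"
    using B.e_line[of n "w n" x] es_w_nonzero[of n] Suc.prems(1) by auto
  have "es k (x - scale c (w n)) = 0" if "n \<le> k" "k \<le> d" for k
    using that c Suc.prems(2)[of k] es_w_above[of n k]
    by (cases "k = n") (auto simp: B.e_simps)
  from Suc.IH[OF _ this] Suc.prems(1) obtain f
    where f: "x - scale c (w n) = (\<Sum>k<n. scale (f k) (w k))" by auto
  then have "x = (\<Sum>k<Suc n. scale ((f(n := c)) k) (w k))"
    by (simp add: diff_eq_eq)
  then show ?case by blast
qed

lemma e_sum_w:
  assumes "k \<le> d"
  shows "e k (\<Sum>l<n. scale (c l) (w l)) = scale (\<Sum>l<n. c l * poly (tau \<theta> l) (\<theta> k)) (e k v0)"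
  using assms by (simp add: A.e_simps A.e_raise A.scale_sum_left)

text \<open>
  The vector \<open>v0\<close> is cyclic for \<open>a\<close> by lemma \<open>span_w\<close>, so no projection \<open>e j\<close> can annihilate it.
\<close>
lemma e_v0_nonzero:
  assumes "j \<le> d"
  shows "e j v0 \<noteq> 0"
proof
  assume z: "e j v0 = 0"
  obtain x where x: "e j x \<noteq> 0" using A.e_nonzero assms by blast
  obtain c where "x = (\<Sum>k<Suc d. scale (c k) (w k))"
    using span_w[of "Suc d" x] by auto
  then have "e j x = 0" by (simp only: e_sum_w[OF assms] z A.scale_zero_right)
  with x show False by contradiction
qed

text \<open>
  The matrix \<open>(\<tau>\<^sub>l(\<theta>\<^sub>k))\<close> is triangular with nonzero diagonal, which lets the coefficients be read off
  one after the other.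
\<close>
lemma coefficients_eq_0:
  assumes "n \<le> Suc d" "m \<le> n" and z: "\<And>k. k < m \<Longrightarrow> e k (\<Sum>l<n. scale (c l) (w l)) = 0"
    and "k < m"
  shows "c k = 0"
  using \<open>k < m\<close>
proof (induction k rule: less_induct)
  case (less k)
  have k: "k \<le> d" using less.prems assms by simp
  have "(\<Sum>l<n. c l * poly (tau \<theta> l) (\<theta> k)) = 0"
    using z[OF less.prems] e_sum_w[OF k] e_v0_nonzero[OF k] by simp
  also have "(\<Sum>l<n. c l * poly (tau \<theta> l) (\<theta> k)) = c k * poly (tau \<theta> k) (\<theta> k)"
  proof (subst sum.remove[of _ k])
    have "c l * poly (tau \<theta> l) (\<theta> k) = 0" if "l \<noteq> k" for l
      using less that by (cases "l < k") (auto simp: poly_tau_eq_0)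
    then have "(\<Sum>l\<in>{..<n} - {k}. c l * poly (tau \<theta> l) (\<theta> k)) = 0"
      by (intro sum.neutral) auto
    then show "c k * poly (tau \<theta> k) (\<theta> k) + (\<Sum>l\<in>{..<n} - {k}. c l * poly (tau \<theta> l) (\<theta> k)) =
        c k * poly (tau \<theta> k) (\<theta> k)" by simp
  qed (use less.prems assms in auto)
  finally show ?case using poly_tau_nonzero[OF A.inj, of k k] k by simp
qed

lemma independent_w:
  assumes "(\<Sum>l\<le>d. scale (c l) (w l)) = 0" "k \<le> d"
  shows "c k = 0"
  using coefficients_eq_0[of "Suc d" "Suc d" c k] assms
  by (simp add: lessThan_Suc_atMost A.e_simps)

lemma split_line:
  assumes "i \<le> d" and "\<And>k. i < k \<Longrightarrow> k \<le> d \<Longrightarrow> es k x = 0" and "\<And>k. k < i \<Longrightarrow> e k x = 0"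
  shows "\<exists>c. x = scale c (w i)"
proof -
  obtain c where c: "x = (\<Sum>k<Suc i. scale (c k) (w k))"
    using span_w[of "Suc i" x] assms(1,2) by (auto simp: Suc_le_eq)
  have "c k = 0" if "k < i" for k
    using coefficients_eq_0[of "Suc i" i c k] assms(1,3) that unfolding c by simp
  with c show ?thesis by auto
qed

lemma b_v0: "b v0 = scale (\<theta>s 0) v0"
  using B.a_e[of 0 v0] by (simp add: es_v0)

text \<open>
  Subtracting \<open>\<theta>s (Suc i)\<close> from \<open>b\<close> removes the leading component of \<open>w (Suc i)\<close> with respect to the \<open>es\<close>,
  while \<open>b\<close> lowers the index with respect to the \<open>e\<close> by one; so the result lies on the line spanned by
  \<open>w i\<close>. It is not zero, since otherwise \<open>e i b e (Suc i)\<close> would vanish.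
\<close>
lemma b_w:
  assumes "Suc i \<le> d"
  shows "\<exists>c. c \<noteq> 0 \<and> b (w (Suc i)) = scale (\<theta>s (Suc i)) (w (Suc i)) + scale c (w i)"
proof -
  define y where "y = b (w (Suc i)) - scale (\<theta>s (Suc i)) (w (Suc i))"
  have e_w: "e k (w (Suc i)) = 0" if "k \<le> i" for k
    using that assms by (subst A.e_raise) (simp_all add: poly_tau_eq_0)
  have "es k y = 0" if "i < k" "k \<le> d" for k
    using that es_w_above[of "Suc i" k] by (cases "k = Suc i") (simp_all add: y_def B.e_simps B.e_a)
  moreover have "e k y = 0" if "k < i" for k
  proof -
    have "e k (b (e j (w (Suc i)))) = 0" if "j \<le> d" for j
      using \<open>k < i\<close> e_b_e[of k j] e_w[of j] that assms by (cases "j \<le> i") (simp_all add: B.a_simps A.e_simps)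
    then have "e k (b (w (Suc i))) = 0" using e_b[of k "w (Suc i)"] that assms by simp
    then show ?thesis using e_w[of k] that assms by (simp add: y_def A.e_simps)
  qed
  ultimately obtain c where c: "y = scale c (w i)"
    using split_line[of i y] assms by auto
  have "c \<noteq> 0"
  proof
    assume "c = 0"
    then have "e i (b (w (Suc i))) = 0"
      using c e_w[of i] assms by (simp add: y_def A.e_simps)
    moreover have "e i (b (e j (w (Suc i)))) = 0" if "j \<le> d" "j \<noteq> Suc i" for j
      using e_b_e[of i j] e_w[of j] that assms by (cases "j \<le> i") (simp_all add: B.a_simps A.e_simps)
    then have "(\<Sum>j\<le>d. e i (b (e j (w (Suc i))))) = e i (b (e (Suc i) (w (Suc i))))"
      using assms by (subst sum.remove[of _ "Suc i"]) (auto simp del: newton_vector.simps)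
    then have "e i (b (w (Suc i))) = e i (b (e (Suc i) (w (Suc i))))"
      using e_b[of i "w (Suc i)"] assms by (simp del: newton_vector.simps)
    ultimately have z: "e i (b (e (Suc i) (w (Suc i)))) = 0" by simp
    have nz: "e (Suc i) (w (Suc i)) \<noteq> 0"
      using e_v0_nonzero[OF assms] poly_tau_nonzero[OF A.inj, of "Suc i" "Suc i"] assms
      by (subst A.e_raise) simp_all
    obtain x where x: "e i (b (e (Suc i) x)) \<noteq> 0" using e_b_e_Suc[of i] assms by auto
    obtain f where "e (Suc i) x = scale f (e (Suc i) (w (Suc i)))"
      using A.e_line[OF assms nz] by blast
    with x z show False using assms by (simp add: B.a_simps A.e_simps)
  qed
  with c show ?thesis by (auto simp: y_def algebra_simps)
qed

text \<open>
  The coefficient in lemma \<open>b_w\<close> is determined by comparing the components in \<open>es 0 V\<close> on both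
  sides.
\<close>
lemma split_sequence:
  assumes t: "\<And>i. i \<le> d \<Longrightarrow> es 0 (w i) = scale (t i) v0" and i: "Suc i \<le> d"
  defines "\<phi> \<equiv> \<lambda>i. (\<theta>s 0 - \<theta>s i) * (t i / t (i - 1))"
  shows "\<phi> (Suc i) \<noteq> 0" "b (w (Suc i)) = scale (\<theta>s (Suc i)) (w (Suc i)) + scale (\<phi> (Suc i)) (w i)"
proof -
  have step: "\<exists>c. c \<noteq> 0 \<and> b (w (Suc i)) = scale (\<theta>s (Suc i)) (w (Suc i)) + scale c (w i) \<and>
      c * t i = (\<theta>s 0 - \<theta>s (Suc i)) * t (Suc i)" if le: "Suc i \<le> d" for i
  proof -
    obtain c where c: "c \<noteq> 0" "b (w (Suc i)) = scale (\<theta>s (Suc i)) (w (Suc i)) + scale c (w i)"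
      using b_w[OF le] by blast
    have "scale (\<theta>s 0) (es 0 (w (Suc i))) = scale (\<theta>s (Suc i)) (es 0 (w (Suc i))) + scale c (es 0 (w i))"
      using arg_cong[OF c(2), of "es 0"] by (simp only: B.e_a B.e_simps le0)
    then have "scale (\<theta>s 0 * t (Suc i)) v0 = scale (\<theta>s (Suc i) * t (Suc i) + c * t i) v0"
      using t[OF le] t[of i] le by (simp del: newton_vector.simps add: A.scale_left_distrib)
    then have "\<theta>s 0 * t (Suc i) = \<theta>s (Suc i) * t (Suc i) + c * t i"
      using v0_nonzero by (simp only: A.scale_cancel_right) simp
    with c show ?thesis by (auto simp: algebra_simps simp del: newton_vector.simps)
  qed
  have nz: "t i \<noteq> 0" if "i \<le> d" for i
    using that
  proof (induction i)
    case 0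
    have "scale 1 v0 = scale (t 0) v0" using t[of 0] by (simp add: es_v0)
    then show ?case using v0_nonzero by (metis A.scale_cancel_right zero_neq_one)
  next
    case (Suc i)
    then show ?case using step[of i] by auto
  qed
  obtain c where c: "c \<noteq> 0" "b (w (Suc i)) = scale (\<theta>s (Suc i)) (w (Suc i)) + scale c (w i)"
      "c * t i = (\<theta>s 0 - \<theta>s (Suc i)) * t (Suc i)"
    using step[OF i] by blast
  then have "\<phi> (Suc i) = c"
    using nz[of i] i by (simp add: \<phi>_def divide_eq_eq mult.commute)
  with c show "\<phi> (Suc i) \<noteq> 0" "b (w (Suc i)) = scale (\<theta>s (Suc i)) (w (Suc i)) + scale (\<phi> (Suc i)) (w i)"
    by (simp_all del: newton_vector.simps)
qed

text \<open>
  The polynomial \<open>\<tau>\<^sub>d\<^sub>+\<^sub>1\<close> vanishes at all eigenvalues of \<open>a\<close>.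
\<close>
lemma w_Suc_d: "w (Suc d) = 0"
  by (rule A.eq_0_if_e_eq_0) (simp add: A.e_raise poly_tau_eq_0 del: newton_vector.simps)

text \<open>
  As \<open>b\<close> is bidiagonal in the basis \<open>w\<close>, the coefficient of \<open>w 0\<close> in \<open>\<tau>\<^sup>*\<^sub>i(b) w\<^sub>k\<close> is
  \<open>\<phi>\<^sub>1 \<cdots> \<phi>\<^sub>i\<close> for \<open>k = i\<close> and zero for all other \<open>k\<close>; and \<open>e 0\<close> picks out that coefficient.
\<close>
lemma e_raise_dual_w:
  assumes b_w: "\<And>i. Suc i \<le> d \<Longrightarrow> b (w (Suc i)) = scale (\<theta>s (Suc i)) (w (Suc i)) + scale (\<phi> (Suc i)) (w i)"
    and "k \<le> d"
  shows "e 0 (B.raise (w k) i) = scale (if i = k then \<Prod>l\<in>{1..i}. \<phi> l else 0) (e 0 v0)"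
  using \<open>k \<le> d\<close>
proof (induction i arbitrary: k)
  case 0
  then show ?case
    using A.e_raise[of 0 v0 k] by (cases "k = 0") (simp_all add: poly_tau_eq_0 del: newton_vector.simps(2))
next
  case (Suc i)
  note hom = module_hom.add[OF B.raise_hom] module_hom.scale[OF B.raise_hom]
  show ?case
  proof (cases k)
    case 0
    have "b (w 0) - scale (\<theta>s i) (w 0) = scale (\<theta>s 0 - \<theta>s i) (w 0)"
      using b_v0 by (simp add: A.scale_left_diff_distrib)
    then have "e 0 (B.raise (w k) (Suc i)) = scale (\<theta>s 0 - \<theta>s i) (e 0 (B.raise (w 0) i))"
      unfolding B.raise_Suc' 0 by (simp only: hom A.e_simps le0)
    then show ?thesis using Suc.IH[of 0] 0 by auto
  next
    case (Suc k')
    have "b (w k) - scale (\<theta>s i) (w k) = scale (\<theta>s k - \<theta>s i) (w k) + scale (\<phi> k) (w k')"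
      using b_w[of k'] Suc.prems Suc by (simp add: A.scale_left_diff_distrib del: newton_vector.simps)
    then have "e 0 (B.raise (w k) (Suc i)) =
        scale (\<theta>s k - \<theta>s i) (e 0 (B.raise (w k) i)) + scale (\<phi> k) (e 0 (B.raise (w k') i))"
      unfolding B.raise_Suc' by (simp only: hom A.e_simps le0)
    also have "\<dots> = scale (if Suc i = k then \<Prod>l\<in>{1..Suc i}. \<phi> l else 0) (e 0 v0)"
      using Suc.IH[of k] Suc.IH[of k'] Suc.prems Suc by (auto simp: prod.nat_ivl_Suc' mult.commute)
    finally show ?thesis .
  qed
qed

text \<open>
  Expand the eigenvector \<open>u\<close> of \<open>a\<close> in the basis \<open>w\<close>. The eigenvalue equation gives
  \<open>c\<^sub>k = (\<theta>\<^sub>0 - \<theta>\<^sub>k\<^sub>+\<^sub>1) c\<^sub>k\<^sub>+\<^sub>1\<close> for its coefficients, and lemma \<open>e_raise_dual_w\<close> gives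
  \<open>s\<^sub>i c\<^sub>0 = \<phi>\<^sub>1 \<cdots> \<phi>\<^sub>i c\<^sub>i\<close>; the quotient of two consecutive such equations is the claim. So the first
  split sequence of the dual system is that of the system itself.
\<close>
lemma dual_first_split_sequence:
  assumes b_w: "\<And>i. Suc i \<le> d \<Longrightarrow> b (w (Suc i)) = scale (\<theta>s (Suc i)) (w (Suc i)) + scale (\<phi> (Suc i)) (w i)"
    and \<phi>: "\<And>i. Suc i \<le> d \<Longrightarrow> \<phi> (Suc i) \<noteq> 0"
    and u: "e 0 u = u" "u \<noteq> 0"
    and s: "\<And>i. i \<le> d \<Longrightarrow> e 0 (B.raise u i) = scale (s i) u" and i: "Suc i \<le> d"
  shows "(\<theta> 0 - \<theta> (Suc i)) * (s (Suc i) / s i) = \<phi> (Suc i)"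
proof -
  obtain c where c: "u = (\<Sum>k<Suc d. scale (c k) (w k))"
    using span_w[of "Suc d" u] by auto
  then have c: "u = (\<Sum>k\<le>d. scale (c k) (w k))" by (simp only: lessThan_Suc_atMost)
  define z where "z = e 0 v0"
  have z: "z \<noteq> 0" using e_v0_nonzero by (simp add: z_def)
  have raise_u: "e 0 (B.raise u i) = scale (c i * (\<Prod>l\<in>{1..i}. \<phi> l)) z" if "i \<le> d" for i
  proof -
    have "e 0 (B.raise u i) = (\<Sum>k\<le>d. scale (c k) (e 0 (B.raise (w k) i)))"
      unfolding c by (simp only: module_hom.sum[OF B.raise_hom] module_hom.scale[OF B.raise_hom] A.e_simps le0)
    also have "\<dots> = (\<Sum>k\<le>d. if k = i then scale (c i * (\<Prod>l\<in>{1..i}. \<phi> l)) z else 0)"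
      using e_raise_dual_w[OF b_w] by (intro sum.cong) (auto simp: z_def)
    finally show ?thesis using that by simp
  qed
  have u_z: "u = scale (c 0) z"
    using raise_u[of 0] u by simp
  have s_c: "s i * c 0 = c i * (\<Prod>l\<in>{1..i}. \<phi> l)" if "i \<le> d" for i
  proof -
    have "scale (s i * c 0) z = scale (c i * (\<Prod>l\<in>{1..i}. \<phi> l)) z"
      using s[OF that] raise_u[OF that] by (simp add: u_z)
    then show ?thesis using z by (simp only: A.scale_cancel_right) simp
  qed
  have "0 = a u - scale (\<theta> 0) u"
    using A.a_e[of 0 u] u by simp
  also have "a u = (\<Sum>k\<le>d. scale (c k * \<theta> k) (w k)) + (\<Sum>k\<le>d. scale (c k) (w (Suc k)))"
    unfolding c by (simp add: A.a_simps sum.distrib[symmetric] A.scale_right_diff_distrib)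
  also have "(\<Sum>k\<le>d. scale (c k) (w (Suc k))) = (\<Sum>k\<le>d. scale (if k = 0 then 0 else c (k - 1)) (w k))"
  proof -
    have "(\<Sum>k\<le>d. scale (c k) (w (Suc k))) = (\<Sum>k\<le>Suc d. scale (if k = 0 then 0 else c (k - 1)) (w k))"
      by (subst sum.atMost_Suc_shift) (simp del: newton_vector.simps)
    then show ?thesis by (simp add: w_Suc_d del: newton_vector.simps)
  qed
  also have "(\<Sum>k\<le>d. scale (c k * \<theta> k) (w k)) + (\<Sum>k\<le>d. scale (if k = 0 then 0 else c (k - 1)) (w k)) - scale (\<theta> 0) u
      = (\<Sum>k\<le>d. scale (c k * \<theta> k + (if k = 0 then 0 else c (k - 1)) - \<theta> 0 * c k) (w k))"
    by (subst c) (simp only: A.scale_sum_right A.scale_scale A.scale_left_distrib A.scale_left_diff_distrib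
        sum.distrib sum_subtractf)
  finally have zero: "0 = (\<Sum>k\<le>d. scale (c k * \<theta> k + (if k = 0 then 0 else c (k - 1)) - \<theta> 0 * c k) (w k))" .
  have "c k * \<theta> k + (if k = 0 then 0 else c (k - 1)) - \<theta> 0 * c k = 0" if "k \<le> d" for k
    by (rule independent_w[OF zero[symmetric] that])
  from this[of "Suc _"] have c_Suc: "c k = (\<theta> 0 - \<theta> (Suc k)) * c (Suc k)" if "Suc k \<le> d" for k
    using that by (simp add: algebra_simps)
  have c_nz: "c k \<noteq> 0" if "k \<le> d" for k
    using that
  proof (induction k)
    case 0
    then show ?case using u_z u(2) by auto
  next
    case (Suc k)
    then show ?case using c_Suc[of k] by auto
  qed
  have p_nz: "(\<Prod>l\<in>{1..k}. \<phi> l) \<noteq> 0" if "k \<le> d" for k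
    using that \<phi> by (induction k) (simp_all add: prod.nat_ivl_Suc')
  have c0: "c 0 \<noteq> 0" using c_nz by simp
  have s_nz: "s i \<noteq> 0" using s_c[of i] c_nz[of i] p_nz[of i] i by auto
  have "s (Suc i) * (c 0 * c i) = (\<phi> (Suc i) * c (Suc i)) * (c 0 * s i)"
  proof -
    have "s (Suc i) * (c 0 * c i) = c (Suc i) * (\<Prod>l\<in>{1..Suc i}. \<phi> l) * c i"
      using s_c[OF i] by (simp flip: mult.assoc)
    also have "\<dots> = c (Suc i) * \<phi> (Suc i) * (c i * (\<Prod>l\<in>{1..i}. \<phi> l))"
      by (simp add: prod.nat_ivl_Suc')
    also have "\<dots> = (\<phi> (Suc i) * c (Suc i)) * (c 0 * s i)"
      using s_c[of i] i by (simp add: mult.commute)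
    finally show ?thesis .
  qed
  then have "s (Suc i) * c i = \<phi> (Suc i) * c (Suc i) * s i"
    using c0 by (simp add: mult.left_commute)
  then have "(\<theta> 0 - \<theta> (Suc i)) * s (Suc i) = \<phi> (Suc i) * s i"
    using c_Suc[OF i] c_nz[OF i] by (simp add: mult_ac)
  then show ?thesis using s_nz by (simp add: divide_eq_eq)
qed

text \<open>
  Here \<open>u\<close> is a multiple of \<open>w d\<close>, and \<open>\<eta>\<^sup>*\<^sub>i(b)\<close> moves \<open>w d\<close> down to a multiple of \<open>w (d - i)\<close>, whose
  component in \<open>e d V\<close> is a known value of \<open>\<tau>\<close>. Applied to the reversed ordering of the \<open>e i\<close>, it
  shows that passing to the dual system reverses the second split sequence.
\<close>
lemma dual_second_split_sequence:
  assumes b_w: "\<And>i. Suc i \<le> d \<Longrightarrow> b (w (Suc i)) = scale (\<theta>s (Suc i)) (w (Suc i)) + scale (\<phi> (Suc i)) (w i)"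
    and \<phi>: "\<And>i. Suc i \<le> d \<Longrightarrow> \<phi> (Suc i) \<noteq> 0"
    and u: "e d u = u" "u \<noteq> 0"
    and y: "y 0 = u" "\<And>i. y (Suc i) = b (y i) - scale (\<theta>s (d - i)) (y i)"
    and s: "\<And>i. i \<le> d \<Longrightarrow> e d (y i) = scale (s i) u" and i: "Suc i \<le> d"
  shows "(\<theta> d - \<theta> (d - Suc i)) * (s (Suc i) / s i) = \<phi> (d - i)"
proof -
  have w_d: "e d (w d) = w d"
    using A.sum_e[of "w d"] by (subst (asm) sum.remove[of _ d]) (simp_all add: A.e_raise poly_tau_eq_0 )
  define z where "z = e d v0"
  have z: "z \<noteq> 0" using e_v0_nonzero by (simp add: z_def)
  have e_w: "e d (w k) = scale (poly (tau \<theta> k) (\<theta> d)) z" for k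
    by (simp add: A.e_raise z_def)
  have nz: "poly (tau \<theta> k) (\<theta> d) \<noteq> 0" if "k \<le> d" for k
    using poly_tau_nonzero[OF A.inj that] by simp
  obtain c where "e d u = scale c (e d (w d))"
    using A.e_line[of d "w d" u] e_w[of d] z nz[of d] by auto
  then have c: "u = scale c (w d)" using u w_d by simp
  have w_z: "w d = scale (poly (tau \<theta> d) (\<theta> d)) z"
    using w_d e_w[of d] by simp
  define P where "P i = (\<Prod>k<i. \<phi> (d - k))" for i
  have y_w: "y i = scale (c * P i) (w (d - i))" if "i \<le> d" for i
    using that
  proof (induction i)
    case 0
    then show ?case by (simp add: y c P_def)
  next
    case (Suc i)
    then have d_i: "d - i = Suc (d - Suc i)" by simp
    show ?case
      using Suc b_w[of "d - Suc i"] unfolding y(2) d_i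
      by (simp add: B.a_simps P_def d_i A.scale_right_distrib mult_ac del: newton_vector.simps)
  qed
  have c_nz: "c \<noteq> 0" using c u(2) by auto
  have s_P: "s i * poly (tau \<theta> d) (\<theta> d) = P i * poly (tau \<theta> (d - i)) (\<theta> d)" if "i \<le> d" for i
  proof -
    have "e d (y i) = scale (c * (P i * poly (tau \<theta> (d - i)) (\<theta> d))) z"
      using y_w[OF that] by (simp add: A.e_simps e_w mult_ac)
    moreover have "scale (s i) u = scale (c * (s i * poly (tau \<theta> d) (\<theta> d))) z"
      unfolding c w_z A.scale_scale by (simp only: mult_ac)
    ultimately have "scale (c * (s i * poly (tau \<theta> d) (\<theta> d))) z = scale (c * (P i * poly (tau \<theta> (d - i)) (\<theta> d))) z"
      using s[OF that] by simp
    then have "c * (s i * poly (tau \<theta> d) (\<theta> d)) = c * (P i * poly (tau \<theta> (d - i)) (\<theta> d))"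
      using z by (simp only: A.scale_cancel_right) simp
    then show ?thesis using c_nz by simp
  qed
  have P_nz: "P i \<noteq> 0" if "i \<le> d" for i
  proof -
    have "\<phi> (d - k) \<noteq> 0" if "k < i" for k
      using \<phi>[of "d - Suc k"] that \<open>i \<le> d\<close> by (simp add: Suc_diff_Suc)
    then show ?thesis by (simp add: P_def)
  qed
  have s_nz: "s i \<noteq> 0"
    using s_P[of i] P_nz[of i] nz[of "d - i"] i by auto
  have tau_eq: "poly (tau \<theta> (d - i)) (\<theta> d) = poly (tau \<theta> (d - Suc i)) (\<theta> d) * (\<theta> d - \<theta> (d - Suc i))"
  proof -
    have "d - i = Suc (d - Suc i)" using i by simp
    then show ?thesis by (simp add: tau_Suc algebra_simps)
  qed
  have "(\<theta> d - \<theta> (d - Suc i)) * s (Suc i) * poly (tau \<theta> d) (\<theta> d) = \<phi> (d - i) * s i * poly (tau \<theta> d) (\<theta> d)"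
  proof -
    have "(\<theta> d - \<theta> (d - Suc i)) * (s (Suc i) * poly (tau \<theta> d) (\<theta> d)) = \<phi> (d - i) * (s i * poly (tau \<theta> d) (\<theta> d))"
      unfolding s_P[OF i] s_P[OF Suc_leD[OF i]] tau_eq P_def by (simp add: mult_ac)
    then show ?thesis by (simp only: mult.assoc)
  qed
  then have "(\<theta> d - \<theta> (d - Suc i)) * s (Suc i) = \<phi> (d - i) * s i"
    using nz[of d] by simp
  then show ?thesis using s_nz by (simp add: divide_eq_eq)
qed

end

section \<open>Simple modules over a matrix algebra\<close>

locale matrix_algebra_module =
  Mat: matrix_algebra_iso scaleA d \<psi> + simple_left_module scaleA scaleV act
  for scaleA :: "'k::field \<Rightarrow> 'a::ring_1 \<Rightarrow> 'a" and d :: nat and \<psi> :: "'a \<Rightarrow> 'k mat"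
    and scaleV :: "'k \<Rightarrow> 'v::ab_group_add \<Rightarrow> 'v" and act :: "'a \<Rightarrow> 'v \<Rightarrow> 'v"
begin

lemma act_hom: "module_hom scaleV scaleV (act x)"
  by unfold_locales (simp_all add: act_add_right act_scale_right)

lemma act_zero_left [simp]: "act 0 v = 0"
  using act_scale_left[of 0 0 v] by simp

lemma act_zero_right [simp]: "act x 0 = 0"
  using act_scale_right[of x 0 0] by simp

lemma act_sum_left: "act (\<Sum>i\<in>I. f i) v = (\<Sum>i\<in>I. act (f i) v)"
  by (induction I rule: infinite_finite_induct) (simp_all add: act_add_left)

lemma act_diff_left: "act (x - y) v = act x v - act y v"
  using act_add_left[of "x - y" y v] by simp

text \<open>
  The annihilator of the module is a two-sided ideal that does not contain \<open>1\<close>.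
\<close>
lemma faithful:
  assumes "x \<noteq> 0"
  shows "\<exists>v. act x v \<noteq> 0"
proof (rule ccontr)
  assume x: "\<not> (\<exists>v. act x v \<noteq> 0)"
  define J where "J = {x. \<forall>v. act x v = 0}"
  have "1 \<in> J"
  proof (rule Mat.two_sided_ideal_contains_one)
    show "x \<in> J" using x by (simp add: J_def)
    show "x + y \<in> J" if "x \<in> J" "y \<in> J" for x y
      using that by (simp add: J_def act_add_left)
    show "y * x * z \<in> J" if "x \<in> J" for x y z
      using that by (simp add: J_def act_mult)
  qed (use assms in \<open>simp_all add: J_def\<close>)
  then have "v = 0" for v :: 'v by (simp add: J_def act_one)
  then show False using nonzero by blast
qed

lemma transitive:
  assumes "v \<noteq> 0"
  shows "\<exists>x. act x v = y"
proof -
  have "range (\<lambda>x. act x v) = {0} \<or> range (\<lambda>x. act x v) = UNIV"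
  proof (rule simple)
    show "Vec.subspace (range (\<lambda>x. act x v))"
    proof (rule Vec.subspaceI)
      show "0 \<in> range (\<lambda>x. act x v)" by (metis act_zero_left rangeI)
      show "x + y \<in> range (\<lambda>x. act x v)" if "x \<in> range (\<lambda>x. act x v)" "y \<in> range (\<lambda>x. act x v)" for x y
        using that by (auto simp flip: act_add_left)
      show "scaleV c x \<in> range (\<lambda>x. act x v)" if "x \<in> range (\<lambda>x. act x v)" for c x
        using that by (auto simp flip: act_scale_left)
    qed
    show "\<forall>x. \<forall>u\<in>range (\<lambda>x. act x v). act x u \<in> range (\<lambda>x. act x v)"
      by (auto simp flip: act_mult)
  qed
  moreover have "v \<in> range (\<lambda>x. act x v)" by (metis act_one rangeI)
  ultimately show ?thesis using assms by (metis UNIV_I image_iff singletonD)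
qed

lemma spectral_operator:
  assumes "idempotent_ordering scaleA d \<psi> A E \<theta>"
  shows "spectral_operator scaleV d (act A) (\<lambda>i. act (E i)) \<theta>"
proof -
  interpret I: primitive_idempotents scaleA d \<psi> A E \<theta>
    by unfold_locales (rule assms)
  show ?thesis
  proof (intro spectral_operator.intro spectral_operator_axioms.intro)
    show "vector_space scaleV" ..
    show "module_hom scaleV scaleV (act A)" by (rule act_hom)
    show "module_hom scaleV scaleV (act (E i))" for i by (rule act_hom)
    show "act (E i) (act (E j) x) = (if i = j then act (E i) x else 0)" if "i \<le> d" "j \<le> d" for i j x
      using I.idempotent_mult[OF that] by (simp flip: act_mult)
    show "(\<Sum>i\<le>d. act (E i) x) = x" for x
      by (simp flip: act_sum_left add: I.sum_idempotents act_one)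
    show "act (E i) (act A x) = scaleV (\<theta> i) (act (E i) x)" if "i \<le> d" for i x
      using I.mult_idempotent[OF that] by (simp flip: act_mult act_scale_left)
    show "act A (act (E i) x) = scaleV (\<theta> i) (act (E i) x)" if "i \<le> d" for i x
      using I.mult_idempotent[OF that] by (simp flip: act_mult act_scale_left)
    show "inj_on \<theta> {..d}" by (rule I.inj_eigenvalues)
    show "\<exists>c. act (E i) y = scaleV c (act (E i) x)" if i: "i \<le> d" and x: "act (E i) x \<noteq> 0" for i x y
    proof -
      obtain z where z: "act z (act (E i) x) = y" using transitive[OF x] by blast
      have "act (E i) y = act (E i * z * E i) x" by (simp add: act_mult z)
      then show ?thesis
        unfolding I.idempotent_sandwich[OF i] act_scale_left by blast
    qed
    show "\<exists>x. act (E i) x \<noteq> 0" if "i \<le> d" for i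
      by (rule faithful[OF I.idempotent_nonzero[OF that]])
  qed
qed

lemma act_poly_in_tau:
  "act (poly_in scaleA (tau \<theta> i) A) v = newton_vector scaleV (act A) \<theta> v i"
  by (induction i)
    (simp_all add: Mat.poly_in_1 Mat.poly_in_tau_Suc act_one act_diff_left act_mult act_scale_left)

lemma act_trace:
  assumes I: "idempotent_ordering scaleA d \<psi> A E \<theta>" and i: "i \<le> d" and v: "act (E i) v = v"
  shows "act (E i) (act x v) = scaleV (mat_trace (\<psi> (x * E i))) v"
proof -
  interpret I: primitive_idempotents scaleA d \<psi> A E \<theta>
    by unfold_locales (rule I)
  have "act (E i) (act x v) = act (E i * x * E i) v" by (simp add: act_mult v)
  then show ?thesis
    unfolding I.idempotent_sandwich[OF i] act_scale_left v .
qed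

end

section \<open>The dual switching element in the split basis\<close>

lemma representing_matrix_eqI:
  assumes "vector_space scaleV" and Y: "represents d scaleV act v Y x"
    and indep: "\<And>c k. (\<Sum>l\<le>d. scaleV (c l) (v l)) = 0 \<Longrightarrow> k \<le> d \<Longrightarrow> c k = 0"
  shows "representing_matrix d scaleV act v x = Y"
  unfolding representing_matrix_def
proof (rule the_equality)
  interpret vector_space scaleV by (rule assms)
  show "represents d scaleV act v Y x" by (rule Y)
  fix Z assume Z: "represents d scaleV act v Z x"
  show "Z = Y"
  proof (rule eq_matI)
    fix i j assume "i < dim_row Y" "j < dim_col Y"
    then have ij: "i \<le> d" "j \<le> d" using Y by (auto simp: represents_def)
    have "(\<Sum>l\<le>d. scaleV (Z $$ (l, j) - Y $$ (l, j)) (v l)) = act x (v j) - act x (v j)"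
      using Y Z ij by (simp add: represents_def scale_left_diff_distrib sum_subtractf)
    then show "Z $$ (i, j) = Y $$ (i, j)"
      using indep[of "\<lambda>l. Z $$ (l, j) - Y $$ (l, j)" i] ij by simp
  qed (use Y Z in \<open>auto simp: represents_def\<close>)
qed

text \<open>
  The vector \<open>v0\<close> spans \<open>E\<^sup>*\<^sub>0V\<close>. The two interpretations \<open>L\<close> and \<open>R\<close> of the operator setting below
  provide the bases \<open>w\<^sub>i = \<tau>\<^sub>i(A) v\<^sub>0\<close> and \<open>w'\<^sub>i = \<eta>\<^sub>i(A) v\<^sub>0\<close>.
\<close>
locale leonard_module = matrix_algebra_module scaleA d \<psi> scaleV act
  for scaleA :: "'k::field \<Rightarrow> 'a::ring_1 \<Rightarrow> 'a" and d :: nat and \<psi> :: "'a \<Rightarrow> 'k mat"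
    and scaleV :: "'k \<Rightarrow> 'v::ab_group_add \<Rightarrow> 'v" and act :: "'a \<Rightarrow> 'v \<Rightarrow> 'v" +
  fixes A As :: 'a and E Es :: "nat \<Rightarrow> 'a" and \<theta> \<theta>s \<phi>1 \<phi>2 :: "nat \<Rightarrow> 'k" and v0 :: 'v
  assumes leonard: "leonard_system scaleA d \<psi> A E As Es"
    and parameters: "parameter_array scaleA d \<psi> A E As Es \<theta> \<theta>s \<phi>1 \<phi>2"
    and v0: "act (Es 0) v0 = v0" "v0 \<noteq> 0"
begin

lemma orderings: "idempotent_ordering scaleA d \<psi> A E \<theta>" "idempotent_ordering scaleA d \<psi> As Es \<theta>s"
  using parameters by (simp_all add: parameter_array_def)

lemma tridiagonal:
  assumes "i \<le> d" "j \<le> d"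
  shows "\<bar>int i - int j\<bar> > 1 \<Longrightarrow> act (E i) (act As (act (E j) x)) = 0"
    and "\<bar>int i - int j\<bar> > 1 \<Longrightarrow> act (Es i) (act A (act (Es j) x)) = 0"
    and "\<bar>int i - int j\<bar> = 1 \<Longrightarrow> \<exists>x. act (E i) (act As (act (E j) x)) \<noteq> 0"
    and "\<bar>int i - int j\<bar> = 1 \<Longrightarrow> \<exists>x. act (Es i) (act A (act (Es j) x)) \<noteq> 0"
proof -
  have *: "(\<bar>int i - int j\<bar> > 1 \<longrightarrow> E i * As * E j = 0 \<and> Es i * A * Es j = 0) \<and>
        (\<bar>int i - int j\<bar> = 1 \<longrightarrow> E i * As * E j \<noteq> 0 \<and> Es i * A * Es j \<noteq> 0)"
    using leonard assms unfolding leonard_system_def by blast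
  show "\<bar>int i - int j\<bar> > 1 \<Longrightarrow> act (E i) (act As (act (E j) x)) = 0"
    "\<bar>int i - int j\<bar> > 1 \<Longrightarrow> act (Es i) (act A (act (Es j) x)) = 0"
    using * by (simp_all flip: act_mult mult.assoc)
  show "\<bar>int i - int j\<bar> = 1 \<Longrightarrow> \<exists>x. act (E i) (act As (act (E j) x)) \<noteq> 0"
    "\<bar>int i - int j\<bar> = 1 \<Longrightarrow> \<exists>x. act (Es i) (act A (act (Es j) x)) \<noteq> 0"
    using * faithful by (simp_all flip: act_mult mult.assoc)
qed

sublocale L: split_operators scaleV d "act A" "\<lambda>i. act (E i)" \<theta> "act As" "\<lambda>i. act (Es i)" \<theta>s v0
proof (intro split_operators.intro split_operators_axioms.intro)
  show "spectral_operator scaleV d (act A) (\<lambda>i. act (E i)) \<theta>"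
    "spectral_operator scaleV d (act As) (\<lambda>i. act (Es i)) \<theta>s"
    by (rule spectral_operator[OF orderings(1)], rule spectral_operator[OF orderings(2)])
qed (use v0 in \<open>auto intro!: tridiagonal\<close>)

sublocale R: split_operators scaleV d "act A" "\<lambda>i. act (E (d - i))" "\<lambda>i. \<theta> (d - i)"
  "act As" "\<lambda>i. act (Es i)" \<theta>s v0
proof (intro split_operators.intro split_operators_axioms.intro)
  show "spectral_operator scaleV d (act A) (\<lambda>i. act (E (d - i))) (\<lambda>i. \<theta> (d - i))"
    by (rule spectral_operator_reverse[OF L.A.spectral_operator_axioms])
  show "spectral_operator scaleV d (act As) (\<lambda>i. act (Es i)) \<theta>s"
    by (rule L.B.spectral_operator_axioms)
qed (use v0 in \<open>auto intro!: tridiagonal\<close>)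

lemma L_w: "L.w i = act (poly_in scaleA (tau \<theta> i) A) v0"
  by (simp add: act_poly_in_tau)

lemma R_w: "R.w i = act (poly_in scaleA (eta d \<theta> i) A) v0"
  by (simp add: act_poly_in_tau eta_eq_tau)

lemma L_split:
  assumes "Suc i \<le> d"
  shows "\<phi>1 (Suc i) \<noteq> 0"
    "act As (L.w (Suc i)) = scaleV (\<theta>s (Suc i)) (L.w (Suc i)) + scaleV (\<phi>1 (Suc i)) (L.w i)"
proof -
  have t: "act (Es 0) (L.w i) = scaleV (mat_trace (\<psi> (poly_in scaleA (tau \<theta> i) A * Es 0))) v0" for i
    unfolding L_w by (rule act_trace[OF orderings(2) _ v0(1)]) simp
  have "\<phi>1 (Suc i) = (\<theta>s 0 - \<theta>s (Suc i)) *
      (mat_trace (\<psi> (poly_in scaleA (tau \<theta> (Suc i)) A * Es 0)) /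
       mat_trace (\<psi> (poly_in scaleA (tau \<theta> (Suc i - 1)) A * Es 0)))"
    using parameters assms by (simp add: parameter_array_def)
  with L.split_sequence[OF t assms] show "\<phi>1 (Suc i) \<noteq> 0"
    "act As (L.w (Suc i)) = scaleV (\<theta>s (Suc i)) (L.w (Suc i)) + scaleV (\<phi>1 (Suc i)) (L.w i)"
    by simp_all
qed

lemma R_split:
  assumes "Suc i \<le> d"
  shows "\<phi>2 (Suc i) \<noteq> 0"
    "act As (R.w (Suc i)) = scaleV (\<theta>s (Suc i)) (R.w (Suc i)) + scaleV (\<phi>2 (Suc i)) (R.w i)"
proof -
  have t: "act (Es 0) (R.w i) = scaleV (mat_trace (\<psi> (poly_in scaleA (eta d \<theta> i) A * Es 0))) v0" for i
    unfolding R_w by (rule act_trace[OF orderings(2) _ v0(1)]) simp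
  have "\<phi>2 (Suc i) = (\<theta>s 0 - \<theta>s (Suc i)) *
      (mat_trace (\<psi> (poly_in scaleA (eta d \<theta> (Suc i)) A * Es 0)) /
       mat_trace (\<psi> (poly_in scaleA (eta d \<theta> (Suc i - 1)) A * Es 0)))"
    using parameters assms by (simp add: parameter_array_def)
  with R.split_sequence[OF t assms] show "\<phi>2 (Suc i) \<noteq> 0"
    "act As (R.w (Suc i)) = scaleV (\<theta>s (Suc i)) (R.w (Suc i)) + scaleV (\<phi>2 (Suc i)) (R.w i)"
    by simp_all
qed

text \<open>
  The eigenvalues of the dual system are those of the system, because an element and its
  primitive idempotents determine them. A vector \<open>u\<close> of \<open>E\<^sub>0V\<close> turns the traces that define the dual split sequences into scalars,
  to which the lemmas on the dual split sequences apply, the first in \<open>L\<close> and the second in \<open>R\<close>.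
\<close>
lemma dual_split_sequences:
  assumes dual: "parameter_array scaleA d \<psi> As Es A E \<theta>s' \<theta>' \<phi>1' \<phi>2'" and i: "Suc i \<le> d"
  shows "\<phi>1' (Suc i) = \<phi>1 (Suc i)" "\<phi>2' (Suc i) = \<phi>2 (d - i)"
proof -
  note idempotents = primitive_idempotents.intro[OF Mat.matrix_algebra_iso_axioms primitive_idempotents_axioms.intro]
  have dual_orderings: "idempotent_ordering scaleA d \<psi> A E \<theta>'" "idempotent_ordering scaleA d \<psi> As Es \<theta>s'"
    using dual by (simp_all add: parameter_array_def)
  have eig: "\<theta>' j = \<theta> j" "\<theta>s' j = \<theta>s j" if "j \<le> d" for j
    by (rule eigenvalues_determined[OF idempotents[OF dual_orderings(1)] idempotents[OF orderings(1)] that],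
        rule eigenvalues_determined[OF idempotents[OF dual_orderings(2)] idempotents[OF orderings(2)] that])
  have tau_eq: "tau \<theta>s' j = tau \<theta>s j" and eta_eq: "eta d \<theta>s' j = eta d \<theta>s j" if "j \<le> d" for j
    unfolding eta_eq_tau by (rule tau_cong, use that eig in simp)+
  obtain u where u: "act (E 0) u = u" "u \<noteq> 0"
    using L.A.e_nonzero[of 0] L.A.e_e[of 0 0] by auto
  define s where "s j = mat_trace (\<psi> (poly_in scaleA (tau \<theta>s j) As * E 0))" for j
  define s' where "s' j = mat_trace (\<psi> (poly_in scaleA (eta d \<theta>s j) As * E 0))" for j
  have s: "act (E 0) (L.B.raise u j) = scaleV (s j) u" for j
    unfolding s_def act_poly_in_tau[symmetric] by (rule act_trace[OF orderings(1) _ u(1)]) simp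
  have "(\<theta> 0 - \<theta> (Suc i)) * (s (Suc i) / s i) = \<phi>1 (Suc i)"
    by (rule L.dual_first_split_sequence[OF L_split(2) L_split(1) u s i]) assumption+
  moreover have "\<phi>1' (Suc i) = (\<theta>' 0 - \<theta>' (Suc i)) *
      (mat_trace (\<psi> (poly_in scaleA (tau \<theta>s' (Suc i)) As * E 0)) /
       mat_trace (\<psi> (poly_in scaleA (tau \<theta>s' (Suc i - 1)) As * E 0)))"
    using dual i by (simp add: parameter_array_def)
  ultimately show "\<phi>1' (Suc i) = \<phi>1 (Suc i)"
    using i by (simp add: eig tau_eq s_def)
  define y where "y j = act (poly_in scaleA (eta d \<theta>s j) As) u" for j
  have y: "y 0 = u" "y (Suc j) = act As (y j) - scaleV (\<theta>s (d - j)) (y j)" for j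
    by (simp_all add: y_def eta_eq_tau act_poly_in_tau Mat.poly_in_1 act_one del: tau_0)
  have s': "act (E (d - d)) (y j) = scaleV (s' j) u" for j
    unfolding y_def s'_def diff_self_eq_0 by (rule act_trace[OF orderings(1) _ u(1)]) simp
  have "(\<theta> (d - d) - \<theta> (d - (d - Suc i))) * (s' (Suc i) / s' i) = \<phi>2 (d - i)"
    by (rule R.dual_second_split_sequence[OF R_split(2) R_split(1) _ u(2) y s' i]) (simp_all add: u)
  then have "(\<theta> 0 - \<theta> (Suc i)) * (s' (Suc i) / s' i) = \<phi>2 (d - i)"
    using i by simp
  moreover have "\<phi>2' (Suc i) = (\<theta>' 0 - \<theta>' (Suc i)) *
      (mat_trace (\<psi> (poly_in scaleA (eta d \<theta>s' (Suc i)) As * E 0)) /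
       mat_trace (\<psi> (poly_in scaleA (eta d \<theta>s' (Suc i - 1)) As * E 0)))"
    using dual i by (simp add: parameter_array_def)
  ultimately show "\<phi>2' (Suc i) = \<phi>2 (d - i)"
    using i by (simp add: eig eta_eq s'_def)
qed

definition switching_ratio :: "nat \<Rightarrow> 'k" where
  "switching_ratio r = (\<Prod>k\<in>{1..r}. \<phi>2 k) / (\<Prod>k\<in>{1..r}. \<phi>1 k)"

lemma switching_ratio_nonzero:
  assumes "r \<le> d"
  shows "switching_ratio r \<noteq> 0"
proof -
  have "\<phi>1 k \<noteq> 0" "\<phi>2 k \<noteq> 0" if "k \<in> {1..r}" for k
    using L_split(1)[of "k - 1"] R_split(1)[of "k - 1"] that assms by simp_all
  then show ?thesis by (simp add: switching_ratio_def)
qed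

definition dual_switch :: 'a where
  "dual_switch = (\<Sum>r\<le>d. scaleA (switching_ratio r) (Es r))"

definition dual_switch_inv :: 'a where
  "dual_switch_inv = (\<Sum>r\<le>d. scaleA (1 / switching_ratio r) (Es r))"

text \<open>
  The definition allows any parameter array of the dual system; all of them give the same element,
  expressed here by the split sequences of the system itself.
\<close>
lemma dual_switching_element_unique:
  assumes "is_dual_switching_element scaleA d \<psi> A E As Es S"
  shows "S = dual_switch"
proof -
  obtain \<theta>s' \<theta>' \<phi>1' \<phi>2' where p: "parameter_array scaleA d \<psi> As Es A E \<theta>s' \<theta>' \<phi>1' \<phi>2'"
    and S: "S = (\<Sum>r\<le>d. scaleA ((\<Prod>k<r. \<phi>2' (d - k)) / (\<Prod>k\<in>{1..r}. \<phi>1' k)) (Es r))"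
    using assms unfolding is_dual_switching_element_def is_switching_element_def by blast
  have "(\<Prod>k<r. \<phi>2' (d - k)) / (\<Prod>k\<in>{1..r}. \<phi>1' k) = switching_ratio r" if r: "r \<le> d" for r
  proof -
    have "\<phi>1' k = \<phi>1 k" if "k \<in> {1..r}" for k
      using dual_split_sequences(1)[OF p, of "k - 1"] that r by simp
    moreover have "\<phi>2' (d - k) = \<phi>2 (Suc k)" if "k < r" for k
      using dual_split_sequences(2)[OF p, of "d - Suc k"] that r by (simp add: Suc_diff_Suc)
    moreover have "(\<Prod>k<r. \<phi>2 (Suc k)) = (\<Prod>k\<in>{1..r}. \<phi>2 k)"
      by (rule prod.reindex_bij_witness[of _ "\<lambda>k. k - 1" Suc]) auto
    ultimately show ?thesis by (simp add: switching_ratio_def)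
  qed
  then show ?thesis unfolding S dual_switch_def by (intro sum.cong) auto
qed

lemma Es_sum:
  assumes i: "i \<le> d"
  shows "Es i * (\<Sum>r\<le>d. scaleA (f r) (Es r)) = scaleA (f i) (Es i)"
proof -
  interpret I: primitive_idempotents scaleA d \<psi> As Es \<theta>s
    by unfold_locales (rule orderings)
  have "Es i * (\<Sum>r\<le>d. scaleA (f r) (Es r)) = (\<Sum>r\<le>d. if r = i then scaleA (f i) (Es i) else 0)"
    unfolding sum_distrib_left using i
    by (intro sum.cong) (auto simp: Mat.scale_mult_right I.idempotent_mult)
  then show ?thesis using i by simp
qed

lemma dual_switch_inverse: "dual_switch * dual_switch_inv = 1" "dual_switch_inv * dual_switch = 1" "inverse_in dual_switch = dual_switch_inv"
proof -
  interpret I: primitive_idempotents scaleA d \<psi> As Es \<theta>s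
    by unfold_locales (rule orderings)
  have "dual_switch * dual_switch_inv = (\<Sum>r\<le>d. scaleA (switching_ratio r) (Es r * dual_switch_inv))"
    by (simp add: dual_switch_def sum_distrib_right Mat.scale_mult_left)
  also have "\<dots> = (\<Sum>r\<le>d. Es r)"
    unfolding dual_switch_inv_def by (intro sum.cong) (auto simp: Es_sum switching_ratio_nonzero)
  finally show 1: "dual_switch * dual_switch_inv = 1" by (simp add: I.sum_idempotents)
  have "dual_switch_inv * dual_switch = (\<Sum>r\<le>d. scaleA (1 / switching_ratio r) (Es r * dual_switch))"
    by (simp add: dual_switch_inv_def sum_distrib_right Mat.scale_mult_left)
  also have "\<dots> = (\<Sum>r\<le>d. Es r)"
    unfolding dual_switch_def by (intro sum.cong) (auto simp: Es_sum switching_ratio_nonzero)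
  finally show 2: "dual_switch_inv * dual_switch = 1" by (simp add: I.sum_idempotents)
  show "inverse_in dual_switch = dual_switch_inv"
    unfolding inverse_in_def
  proof (rule the_equality)
    fix y assume "dual_switch * y = 1 \<and> y * dual_switch = 1"
    then have "y = dual_switch_inv * dual_switch * y" "dual_switch * y = 1" by (simp_all add: 2)
    then show "y = dual_switch_inv" by (simp add: mult.assoc)
  qed (simp add: 1 2)
qed

lemma dual_switch_R_w:
  assumes "i \<le> d"
  shows "act dual_switch (R.w i) = scaleV (switching_ratio i) (L.w i)"
  unfolding switching_ratio_def
proof (rule L.B.intertwiner_on_split_vectors[where S = "act dual_switch" and u = L.w and u' = R.w, OF _ _ _ _ _ _ _ _ _ assms])
  interpret I: primitive_idempotents scaleA d \<psi> As Es \<theta>s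
    by unfold_locales (rule orderings)
  show "module_hom scaleV scaleV (act dual_switch)" by (rule act_hom)
  have "dual_switch * As = As * dual_switch"
    unfolding dual_switch_def sum_distrib_left sum_distrib_right
    by (intro sum.cong) (simp_all add: Mat.scale_mult_left Mat.scale_mult_right I.mult_idempotent)
  then show "act dual_switch (act As x) = act As (act dual_switch x)" for x
    by (simp flip: act_mult)
  show "act (Es i) (act dual_switch x) = scaleV ((\<Prod>k = 1..i. \<phi>2 k) / (\<Prod>k = 1..i. \<phi>1 k)) (act (Es i) x)"
    if "i \<le> d" for i x
    using Es_sum[OF that, of switching_ratio] by (simp flip: act_mult act_scale_left add: dual_switch_def switching_ratio_def)
  show "act (Es i) (L.w i) = act (Es i) (R.w i)" if "i \<le> d" for i
    using that by (induction i) (simp_all add: L.es_w_Suc R.es_w_Suc del: newton_vector.simps(2))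
qed (use L_split R_split v0 in \<open>simp_all del: newton_vector.simps(2)\<close>)

lemma dual_switch_inv_L_w:
  assumes "i \<le> d"
  shows "act dual_switch_inv (L.w i) = scaleV (1 / switching_ratio i) (R.w i)"
proof -
  have "R.w i = act dual_switch_inv (act dual_switch (R.w i))"
    by (simp flip: act_mult add: dual_switch_inverse act_one)
  also have "\<dots> = scaleV (switching_ratio i) (act dual_switch_inv (L.w i))"
    by (simp add: dual_switch_R_w[OF assms] act_scale_right)
  finally show ?thesis using switching_ratio_nonzero[OF assms] by simp
qed

text \<open>
  The transition matrices between the two bases consist of connection coefficients of polynomials.
\<close>
lemma L_w_eq_sum: "L.w j = (\<Sum>i\<le>j. scaleV (connection d \<theta> j i) (R.w i))"
  unfolding L_w R_w tau_eq_sum_eta[of \<theta> j d] Mat.poly_in_sum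
  by (simp add: Mat.poly_in_smult act_sum_left act_scale_left)

lemma R_w_eq_sum:
  assumes "j \<le> d"
  shows "R.w j = (\<Sum>i\<le>j. scaleV (connection d (\<lambda>h. \<theta> (d - h)) j i) (L.w i))"
proof -
  have "eta d (\<lambda>h. \<theta> (d - h)) i = tau \<theta> i" if "i \<le> j" for i
    unfolding eta_eq_tau by (rule tau_cong) (use that assms in simp)
  then have "eta d \<theta> j = (\<Sum>i\<le>j. smult (connection d (\<lambda>h. \<theta> (d - h)) j i) (tau \<theta> i))"
    unfolding eta_eq_tau[of d \<theta>] tau_eq_sum_eta[of "\<lambda>h. \<theta> (d - h)" j d] by (intro sum.cong) auto
  then show ?thesis
    unfolding L_w R_w
    by (simp only: Mat.poly_in_sum) (simp add: Mat.poly_in_smult act_sum_left act_scale_left)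
qed

lemma split_matrix_eqI:
  assumes "\<And>j. j \<le> d \<Longrightarrow> act x (L.w j) = (\<Sum>i\<le>j. scaleV (f i j) (L.w i))"
  shows "split_matrix d scaleA scaleV act A \<theta> v0 x =
    mat (d + 1) (d + 1) (\<lambda>(i, j). if i \<le> j then f i j else 0)"
  unfolding split_matrix_def L_w[symmetric]
proof (rule representing_matrix_eqI)
  show "vector_space scaleV" ..
  show "c k = 0" if "(\<Sum>l\<le>d. scaleV (c l) (L.w l)) = 0" "k \<le> d" for c k
    using L.independent_w that by blast
  show "represents d scaleV act L.w (mat (d + 1) (d + 1) (\<lambda>(i, j). if i \<le> j then f i j else 0)) x"
    unfolding represents_def
  proof (intro conjI allI impI)
    fix j assume j: "j \<le> d"
    have "(\<Sum>i\<le>j. scaleV (f i j) (L.w i)) = (\<Sum>i\<le>d. scaleV (if i \<le> j then f i j else 0) (L.w i))"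
      using j by (intro sum.mono_neutral_cong_left) auto
    then show "act x (L.w j) = (\<Sum>i\<le>d. scaleV (mat (d + 1) (d + 1) (\<lambda>(i, j). if i \<le> j then f i j else 0) $$ (i, j)) (L.w i))"
      using assms[OF j] j by simp
  qed simp
qed

lemma split_matrix_dual_switch:
  "split_matrix d scaleA scaleV act A \<theta> v0 dual_switch =
    mat (d + 1) (d + 1) (\<lambda>(i, j). if i \<le> j then connection d \<theta> j i * switching_ratio i else 0)"
proof (rule split_matrix_eqI)
  fix j assume j: "j \<le> d"
  have "act dual_switch (L.w j) = (\<Sum>i\<le>j. scaleV (connection d \<theta> j i) (act dual_switch (R.w i)))"
    unfolding L_w_eq_sum[of j] by (simp only: module_hom.sum[OF act_hom] module_hom.scale[OF act_hom])
  also have "\<dots> = (\<Sum>i\<le>j. scaleV (connection d \<theta> j i * switching_ratio i) (L.w i))"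
    using j by (intro sum.cong) (simp_all add: dual_switch_R_w)
  finally show "act dual_switch (L.w j) = (\<Sum>i\<le>j. scaleV (connection d \<theta> j i * switching_ratio i) (L.w i))" .
qed

lemma split_matrix_dual_switch_inv:
  "split_matrix d scaleA scaleV act A \<theta> v0 dual_switch_inv =
    mat (d + 1) (d + 1) (\<lambda>(i, j). if i \<le> j then 1 / switching_ratio j * connection d (\<lambda>h. \<theta> (d - h)) j i else 0)"
proof (rule split_matrix_eqI)
  fix j assume j: "j \<le> d"
  show "act dual_switch_inv (L.w j) = (\<Sum>i\<le>j. scaleV (1 / switching_ratio j * connection d (\<lambda>h. \<theta> (d - h)) j i) (L.w i))"
    unfolding dual_switch_inv_L_w[OF j] R_w_eq_sum[OF j] by (simp add: Vec.scale_sum_right)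
qed

end

theorem theorem12p8:
  fixes d :: nat
    and scaleA :: "'k::field \<Rightarrow> 'a::ring_1 \<Rightarrow> 'a"
    and scaleV :: "'k \<Rightarrow> 'v::ab_group_add \<Rightarrow> 'v"
    and act :: "'a \<Rightarrow> 'v \<Rightarrow> 'v"
    and \<psi> :: "'a \<Rightarrow> 'k mat"
    and A As Ss :: 'a
    and E Es :: "nat \<Rightarrow> 'a"
    and \<theta> \<theta>s \<phi>1 \<phi>2 :: "nat \<Rightarrow> 'k"
    and q :: "'k alg_closure"
    and v0 :: 'v
  assumes "matrix_algebra_iso scaleA d \<psi>"
    and "simple_left_module scaleA scaleV act"
    and "leonard_system scaleA d \<psi> A E As Es"
    and "parameter_array scaleA d \<psi> A E As Es \<theta> \<theta>s \<phi>1 \<phi>2"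
    and "base_scalar d \<theta> \<theta>s q"
    and "is_dual_switching_element scaleA d \<psi> A E As Es Ss"
    and "v0 \<in> range (act (Es 0))" and "v0 \<noteq> 0"
  shows "let M = split_matrix d scaleA scaleV act A \<theta> v0 Ss;
             N = split_matrix d scaleA scaleV act A \<theta> v0 (inverse_in Ss)
         in upper_triangular M \<and> upper_triangular N \<and>
            (\<forall>i j. i \<le> j \<and> j \<le> d \<longrightarrow>
               to_ac (M $$ (i, j)) =
                 bracket q i (j - i) (d - j) *
                 to_ac ((\<Prod>k\<in>{1..i}. \<phi>2 k) * poly (tau \<theta> (j - i)) (\<theta> d) / (\<Prod>k\<in>{1..i}. \<phi>1 k)) \<and>
               to_ac (N $$ (i, j)) =
                 bracket q i (j - i) (d - j) *
                 to_ac ((\<Prod>k\<in>{1..j}. \<phi>1 k) * poly (eta d \<theta> (j - i)) (\<theta> 0) / (\<Prod>k\<in>{1..j}. \<phi>2 k)))"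
proof -
  interpret module: matrix_algebra_module scaleA d \<psi> scaleV act
    by (intro matrix_algebra_module.intro assms)
  have "idempotent_ordering scaleA d \<psi> As Es \<theta>s"
    using assms(4) by (simp add: parameter_array_def)
  then interpret I: spectral_operator scaleV d "act As" "\<lambda>i. act (Es i)" \<theta>s
    by (rule module.spectral_operator)
  have "act (Es 0) v0 = v0"
    using assms(7) I.e_e[of 0 0] by auto
  then interpret leonard_module scaleA d \<psi> scaleV act A As E Es \<theta> \<theta>s \<phi>1 \<phi>2 v0
    using assms by unfold_locales auto
  have S: "Ss = leonard_module.dual_switch scaleA d Es \<phi>1 \<phi>2"
    by (rule dual_switching_element_unique[OF assms(6)])
  note inj = L.A.inj
  note q = base_scalar_three_term[OF assms(5) inj]
  have c: "to_ac (connection d \<theta> j i) = bracket q i (j - i) (d - j) * to_ac (poly (tau \<theta> (j - i)) (\<theta> d))"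
    if "i \<le> j" "j \<le> d" for i j
    by (rule connection_eq_bracket[OF q inj that])
  have c': "to_ac (connection d (\<lambda>h. \<theta> (d - h)) j i) =
      bracket q i (j - i) (d - j) * to_ac (poly (eta d \<theta> (j - i)) (\<theta> 0))"
    if "i \<le> j" "j \<le> d" for i j
    using connection_eq_bracket[OF q(1) three_term_reverse[OF q(2)] R.A.inj that]
    by (simp add: eta_eq_tau)
  show ?thesis
    unfolding Let_def S dual_switch_inverse split_matrix_dual_switch split_matrix_dual_switch_inv
    by (auto simp: upper_triangular_def c c' switching_ratio_def)
qed

end
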